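(* Let $X$ be the Cantor set, let $U,V\subset X$ be open sets such that $X_U:=X\setminus U$ and $X_V:=X\setminus V$ are nonempty, finite and disjoint from each other, and let $h:U\to V$ be a minimal homeomorphism. Let $\{\mathcal P_n\}_{n\ge 0}$ be any admissible sequence of Kakutani-Rokhlin partitions for $(X,h)$, let $B=(V,E,\ge)$ be the ordered Bratteli diagram constructed from $\{\mathcal P_n\}_{n\ge 0}$, and let $\lambda: X_B\setminus X_B^{\max}\to X_B\setminus X_B^{\min}$ be its Vershik map. Then the partial actions $(X,h)$ and $(X_B,\lambda)$ of $\mathbb Z$ are isomorphic.
   Context: **Partial homeomorphisms and partial actions.** For a homeomorphism $h:U\to V$ between open subsets of a space $X$, the iterates $h^n$ ($n\in\mathbb Z$) are taken on their natural domains: $h^0=\mathrm{id}_X$; for $n\ge1$, $\mathrm{dom}(h^n)$ is the set of $x$ with $x,h(x),\dots,h^{n-1}(x)\in U$; and $h^{-n}=(h^{-1})^n$. The orbit of $x\in X$ is $O(x)=\{h^n(x)\mid n\in\mathbb Z,\ h^n(x)\text{ is defined}\}$, and $h$ is *minimal* if $O(x)$ is dense in $X$ for every $x\in X$. $(X,h)$ denotes the partial action $(\{X_n\}_{n\in\mathbb Z},\{h^n\}_{n\in\mathbb Z})$ of $\mathbb Z$ on $X$, where $X_{-n}=\mathrm{dom}(h^n)$, so $h^n:X_{-n}\to X_n$ is a homeomorphism. A *morphism* from $(\{X_n\},\{\alpha_n\})$ on $X$ to $(\{Y_n\},\{\beta_n\})$ on $Y$ is a continuous map $\phi:X\to Y$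 such that, for all $n\in\mathbb Z$, $\phi(X_n)\subseteq Y_n$ and $\beta_n\circ\phi=\phi\circ\alpha_n$ on $X_{-n}$. Two partial actions are isomorphic if there are mutually inverse morphisms between them. **Kakutani-Rokhlin partitions.** A Kakutani-Rokhlin partition for $(X,h)$ is a partition $\{E(k,j)\mid 1\le k\le K,\ 1\le j\le J(k)\}$ of $X$ into (nonempty) clopen sets, with $K,J(1),\dots,J(K)$ positive integers, such that: (1) $X_U\subset\bigcup_k E(k,J(k))$ and $X_V\subset\bigcup_k E(k,1)$; (2) $h(E(k,j))=E(k,j+1)$ for $1\le k\le K$, $1\le j<J(k)$; (3) $\bigcup_k h(E(k,J(k))\setminus X_U)\cup X_V=\bigcup_k E(k,1)$. The collection $\{E(k,j)\mid 1\le j\le J(k)\}$ is the $k$-th tower. **Admissible sequences.** Call a sequence of Kakutani-Rokhlin partitions $\mathcal P_n=\{E(n,k,j)\mid 1\le k\le K_n,\ 1\le j\le J(n,k)\}$, $n\ge0$, *admissible* if $\mathcal P_0=\{X\}$ (that is, $K_0=1$, $J(0,1)=1$, $E(0,1,1)=X$) and: (i) $\{\bigcup_{k=1}^{K_n}E(n,k,1)\}_{n\ge0}$ is a decreasing sequence of clopen sets with intersection $X_V$; (ii) $\mathcal P_{n+1}$ is finer than $\mathcal P_n$ for all $n\geq 0$; (iii) $\bigcup_n\mathcal P_n$ generates the topology of $X$. **Bratteli diagrams.** A Bratteli diagram $(V,E)$ is an infinite directed graph with vertex set $V=\bigsqcup_{n\ge0}V_n$ and edge set $E=\bigsqcup_{n\ge1}E_n$,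 all $V_n,E_n$ finite and nonempty, $V_0=\{v_0\}$ a single vertex, with range and source maps $r,s:E\to V$ satisfying $r(E_n)=V_n$, $s(E_n)=V_{n-1}$, with $s^{-1}(v)\ne\emptyset$ for all $v\in V$ and $r^{-1}(v)\neq\emptyset$ for all $v\in V\setminus V_0$. An ordered Bratteli diagram $(V,E,\ge)$ carries in addition a partial order on $E$ in which two edges $e,e'$ are comparable if and only if $r(e)=r(e')$. (The vertex set is also denoted $V$; it is unrelated to the open set $V\subset X$.) **Diagram constructed from an admissible sequence.** Put $V_n=\{(n,1),\dots,(n,K_n)\}$ for $n\ge0$, and for $n\ge1$ let $E_n$ be the set of all $(n,m,k,j')$ with $1\le m\le K_{n-1}$, $1\le k\le K_n$, $j'\ge0$, $j'+J(n-1,m)\le J(n,k)$ and $E(n,k,j+j')\subset E(n-1,m,j)$ for all $1\le j\le J(n-1,m)$. Set $r(n,m,k,j')=(n,k)$, $s(n,m,k,j')=(n-1,m)$, and $(n,m_1,k,j_1)\ge(n,m_2,k,j_2)$ iff $j_1\ge j_2$. This is an ordered Bratteli diagram. **Vershik map.** For an ordered Bratteli diagram $B$, let $X_B=\{\xi\in\prod_{n\ge1}E_n\mid r(\xi_j)=s(\xi_{j+1})\ \forall j\ge1\}$ with the product topology (each $E_n$ discrete). Each $r^{-1}(v)$, $v\notin V_0$, is linearly ordered; $E_n^{\max}$ (resp. $E_n^{\min}$) is the set of edges $e\in E_n$ that are maximal (resp. minimal) in $r^{-1}(r(e))$. Let $X_B^{\max}=\{\xi\in X_B\mid\xi_j\in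 E_j^{\max}\ \forall j\}$ and $X_B^{\min}=\{\xi\in X_B\mid\xi_j\in E_j^{\min}\ \forall j\}$. For $\xi\in X_B\setminus X_B^{\max}$ let $n$ be least with $\xi_n\notin E_n^{\max}$ and set $\lambda(\xi)=g_1\cdots g_{n-1}g_n\xi_{n+1}\xi_{n+2}\cdots$, where $g_n$ is the successor of $\xi_n$ in $r^{-1}(r(\xi_n))$ and $g_1\cdots g_{n-1}$ is the unique path from $v_0$ to $s(g_n)$ with $g_j\in E_j^{\min}$ for all $j\leq n-1$. The map $\lambda$ is a homeomorphism from $X_B\setminus X_B^{\max}$ onto $X_B\setminus X_B^{\min}$. *)

theory Defs
  imports "HOL-Analysis.Analysis"
begin

section \<open>Cantor spaces\<close>

definition cantor_space :: "'a topology \<Rightarrow> bool" where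
  "cantor_space X \<longleftrightarrow>
     X homeomorphic_space product_topology (\<lambda>_::nat. discrete_topology (UNIV :: bool set)) UNIV"


section \<open>Partial homeomorphisms and partial actions of the integers\<close>

text \<open>
  A homeomorphism \<open>h : U \<rightarrow> V\<close> between open subsets of \<open>X\<close> is represented by the two sets
  and a total function \<open>h\<close> whose values outside \<open>U\<close> are irrelevant; its inverse is
  \<open>inv_into U h\<close>, of which only the values on \<open>V\<close> matter.
\<close>

definition iterate_dom :: "'a set \<Rightarrow> 'a set \<Rightarrow> ('a \<Rightarrow> 'a) \<Rightarrow> nat \<Rightarrow> 'a set" where
  "iterate_dom S U f n = {x \<in> S. \<forall>i<n. (f ^^ i) x \<in> U}"

definition zpower_dom :: "'a set \<Rightarrow> 'a set \<Rightarrow> 'a set \<Rightarrow> ('a \<Rightarrow> 'a) \<Rightarrow> int \<Rightarrow> 'a set" where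
  "zpower_dom S U V h n =
     (if n \<ge> 0 then iterate_dom S U h (nat n) else iterate_dom S V (inv_into U h) (nat (- n)))"

definition zpower :: "'a set \<Rightarrow> ('a \<Rightarrow> 'a) \<Rightarrow> int \<Rightarrow> 'a \<Rightarrow> 'a" where
  "zpower U h n = (if n \<ge> 0 then h ^^ nat n else inv_into U h ^^ nat (- n))"

definition partial_orbit :: "'a set \<Rightarrow> 'a set \<Rightarrow> 'a set \<Rightarrow> ('a \<Rightarrow> 'a) \<Rightarrow> 'a \<Rightarrow> 'a set" where
  "partial_orbit S U V h x = {zpower U h n x | n. x \<in> zpower_dom S U V h n}"

definition minimal_partial_homeo :: "'a topology \<Rightarrow> 'a set \<Rightarrow> 'a set \<Rightarrow> ('a \<Rightarrow> 'a) \<Rightarrow> bool" where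
  "minimal_partial_homeo X U V h \<longleftrightarrow>
     (\<forall>x \<in> topspace X. X closure_of partial_orbit (topspace X) U V h x = topspace X)"

text \<open>
  The data \<open>({X\<^sub>n}, {\<alpha>\<^sub>n})\<close> of a partial action: \<open>act_map A n\<close> is meaningful only on
  \<open>act_ran A (- n)\<close>, which it maps onto \<open>act_ran A n\<close>.
\<close>

record 'a zaction =
  act_space :: "'a topology"
  act_ran :: "int \<Rightarrow> 'a set"
  act_map :: "int \<Rightarrow> 'a \<Rightarrow> 'a"

definition partial_action :: "'a topology \<Rightarrow> 'a set \<Rightarrow> 'a set \<Rightarrow> ('a \<Rightarrow> 'a) \<Rightarrow> 'a zaction" where
  "partial_action X U V h =
     \<lparr> act_space = X,
       act_ran = (\<lambda>n. zpower_dom (topspace X) U V h (- n)),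
       act_map = zpower U h \<rparr>"

definition action_morphism :: "'a zaction \<Rightarrow> 'b zaction \<Rightarrow> ('a \<Rightarrow> 'b) \<Rightarrow> bool" where
  "action_morphism A B \<phi> \<longleftrightarrow>
     continuous_map (act_space A) (act_space B) \<phi> \<and>
     (\<forall>n. \<phi> ` act_ran A n \<subseteq> act_ran B n \<and>
          (\<forall>x \<in> act_ran A (- n). act_map B n (\<phi> x) = \<phi> (act_map A n x)))"

definition isomorphic_actions :: "'a zaction \<Rightarrow> 'b zaction \<Rightarrow> bool" where
  "isomorphic_actions A B \<longleftrightarrow>
     (\<exists>\<phi> \<psi>. action_morphism A B \<phi> \<and> action_morphism B A \<psi> \<and>
            (\<forall>x \<in> topspace (act_space A). \<psi> (\<phi> x) = x) \<and>
            (\<forall>y \<in> topspace (act_space B). \<phi> (\<psi> y) = y))"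


section \<open>Kakutani-Rokhlin partitions\<close>

text \<open>
  Partitions are indexed families: towers \<open>k \<in> {1..K}\<close>, floors \<open>j \<in> {1..J k}\<close>; values of
  \<open>J\<close> and \<open>E\<close> at other indices are irrelevant. The sets \<open>X\<^sub>U\<close> and \<open>X\<^sub>V\<close> are
  \<open>topspace X - U\<close> and \<open>topspace X - V\<close>.
\<close>

definition kr_index :: "nat \<Rightarrow> (nat \<Rightarrow> nat) \<Rightarrow> (nat \<times> nat) set" where
  "kr_index K J = (SIGMA k:{1..K}. {1..J k})"

definition kr_partition ::
  "'a topology \<Rightarrow> 'a set \<Rightarrow> 'a set \<Rightarrow> ('a \<Rightarrow> 'a) \<Rightarrow>
   nat \<Rightarrow> (nat \<Rightarrow> nat) \<Rightarrow> (nat \<Rightarrow> nat \<Rightarrow> 'a set) \<Rightarrow> bool" where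
  "kr_partition X U V h K J E \<longleftrightarrow>
     K \<ge> 1 \<and> (\<forall>k\<in>{1..K}. J k \<ge> 1) \<and>
     (\<forall>(k, j) \<in> kr_index K J. E k j \<noteq> {} \<and> openin X (E k j) \<and> closedin X (E k j)) \<and>
     disjoint_family_on (\<lambda>(k, j). E k j) (kr_index K J) \<and>
     (\<Union>(k, j) \<in> kr_index K J. E k j) = topspace X \<and>
     topspace X - U \<subseteq> (\<Union>k\<in>{1..K}. E k (J k)) \<and>
     topspace X - V \<subseteq> (\<Union>k\<in>{1..K}. E k 1) \<and>
     (\<forall>k\<in>{1..K}. \<forall>j. 1 \<le> j \<and> j < J k \<longrightarrow> h ` E k j = E k (j + 1)) \<and>
     (\<Union>k\<in>{1..K}. h ` (E k (J k) - (topspace X - U))) \<union> (topspace X - V)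
       = (\<Union>k\<in>{1..K}. E k 1)"

definition admissible ::
  "'a topology \<Rightarrow> 'a set \<Rightarrow> 'a set \<Rightarrow> ('a \<Rightarrow> 'a) \<Rightarrow>
   (nat \<Rightarrow> nat) \<Rightarrow> (nat \<Rightarrow> nat \<Rightarrow> nat) \<Rightarrow> (nat \<Rightarrow> nat \<Rightarrow> nat \<Rightarrow> 'a set) \<Rightarrow> bool" where
  "admissible X U V h K J E \<longleftrightarrow>
     (\<forall>n. kr_partition X U V h (K n) (J n) (E n)) \<and>
     K 0 = 1 \<and> J 0 1 = 1 \<and> E 0 1 1 = topspace X \<and>
     decseq (\<lambda>n. \<Union>k\<in>{1..K n}. E n k 1) \<and>
     (\<Inter>n. \<Union>k\<in>{1..K n}. E n k 1) = topspace X - V \<and>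
     (\<forall>n. \<forall>(k, j) \<in> kr_index (K (Suc n)) (J (Suc n)).
        \<exists>(m, i) \<in> kr_index (K n) (J n). E (Suc n) k j \<subseteq> E n m i) \<and>
     X = topology_generated_by (\<Union>n. (\<lambda>(k, j). E n k j) ` kr_index (K n) (J n))"


section \<open>Ordered Bratteli diagrams\<close>

text \<open>
  Only \<open>bd_edges B n\<close> with \<open>n \<ge> 1\<close> is part of the diagram. A pair \<open>(e, e')\<close> in \<open>bd_le B\<close>
  means \<open>e \<le> e'\<close>.
\<close>

record ('v, 'e) bratteli =
  bd_verts :: "nat \<Rightarrow> 'v set"
  bd_edges :: "nat \<Rightarrow> 'e set"
  bd_rng :: "'e \<Rightarrow> 'v"
  bd_src :: "'e \<Rightarrow> 'v"
  bd_le :: "'e rel"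

definition bd_all_edges :: "('v, 'e) bratteli \<Rightarrow> 'e set" where
  "bd_all_edges B = (\<Union>n\<in>{1..}. bd_edges B n)"

definition bd_in_edges :: "('v, 'e) bratteli \<Rightarrow> 'v \<Rightarrow> 'e set" where
  "bd_in_edges B v = {e \<in> bd_all_edges B. bd_rng B e = v}"

definition ordered_bratteli :: "('v, 'e) bratteli \<Rightarrow> bool" where
  "ordered_bratteli B \<longleftrightarrow>
     (\<exists>v0. bd_verts B 0 = {v0}) \<and>
     (\<forall>n. finite (bd_verts B n) \<and> bd_verts B n \<noteq> {}) \<and>
     (\<forall>n\<ge>1. finite (bd_edges B n) \<and> bd_edges B n \<noteq> {}) \<and>
     disjoint_family (bd_verts B) \<and> disjoint_family_on (bd_edges B) {1..} \<and>
     (\<forall>n\<ge>1. bd_rng B ` bd_edges B n = bd_verts B n \<and>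
             bd_src B ` bd_edges B n = bd_verts B (n - 1)) \<and>
     (\<forall>n. \<forall>v \<in> bd_verts B n. \<exists>e \<in> bd_all_edges B. bd_src B e = v) \<and>
     (\<forall>n\<ge>1. \<forall>v \<in> bd_verts B n. bd_in_edges B v \<noteq> {}) \<and>
     partial_order_on (bd_all_edges B) (bd_le B) \<and>
     (\<forall>e \<in> bd_all_edges B. \<forall>e' \<in> bd_all_edges B.
        (e, e') \<in> bd_le B \<or> (e', e) \<in> bd_le B \<longleftrightarrow> bd_rng B e = bd_rng B e')"

definition bd_max_edges :: "('v, 'e) bratteli \<Rightarrow> nat \<Rightarrow> 'e set" where
  "bd_max_edges B n =
     {e \<in> bd_edges B n. \<forall>e' \<in> bd_in_edges B (bd_rng B e). (e, e') \<in> bd_le B \<longrightarrow> e' = e}"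

definition bd_min_edges :: "('v, 'e) bratteli \<Rightarrow> nat \<Rightarrow> 'e set" where
  "bd_min_edges B n =
     {e \<in> bd_edges B n. \<forall>e' \<in> bd_in_edges B (bd_rng B e). (e', e) \<in> bd_le B \<longrightarrow> e' = e}"

text \<open>Immediate successor in the linearly ordered set of edges with the same range.\<close>

definition bd_succ :: "('v, 'e) bratteli \<Rightarrow> 'e \<Rightarrow> 'e" where
  "bd_succ B e =
     (THE g. g \<in> bd_in_edges B (bd_rng B e) \<and> (e, g) \<in> bd_le B \<and> g \<noteq> e \<and>
        (\<forall>g' \<in> bd_in_edges B (bd_rng B e). (e, g') \<in> bd_le B \<and> g' \<noteq> e \<longrightarrow> (g, g') \<in> bd_le B))"

text \<open>
  Infinite paths are indexed by \<open>{1..}\<close> as elements of the extensional product, so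
  their value at \<open>0\<close> is \<open>undefined\<close>.
\<close>

definition bd_paths :: "('v, 'e) bratteli \<Rightarrow> (nat \<Rightarrow> 'e) set" where
  "bd_paths B =
     {\<xi> \<in> (\<Pi>\<^sub>E n\<in>{1..}. bd_edges B n). \<forall>j\<ge>1. bd_rng B (\<xi> j) = bd_src B (\<xi> (j + 1))}"

definition bd_path_space :: "('v, 'e) bratteli \<Rightarrow> (nat \<Rightarrow> 'e) topology" where
  "bd_path_space B =
     subtopology (product_topology (\<lambda>n. discrete_topology (bd_edges B n)) {1..}) (bd_paths B)"

definition bd_max_paths :: "('v, 'e) bratteli \<Rightarrow> (nat \<Rightarrow> 'e) set" where
  "bd_max_paths B = {\<xi> \<in> bd_paths B. \<forall>j\<ge>1. \<xi> j \<in> bd_max_edges B j}"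

definition bd_min_paths :: "('v, 'e) bratteli \<Rightarrow> (nat \<Rightarrow> 'e) set" where
  "bd_min_paths B = {\<xi> \<in> bd_paths B. \<forall>j\<ge>1. \<xi> j \<in> bd_min_edges B j}"

text \<open>
  The unique path \<open>g\<^sub>1 \<dots> g\<^bsub>n-1\<^esub>\<close> of minimal edges from the top vertex to \<open>v\<close>, a vertex
  at level \<open>n - 1\<close>; for \<open>n = 1\<close> it is empty. It starts at the top vertex automatically,
  because \<open>g\<^sub>1\<close> is an edge of the first level.
\<close>

definition bd_min_path_to :: "('v, 'e) bratteli \<Rightarrow> nat \<Rightarrow> 'v \<Rightarrow> nat \<Rightarrow> 'e" where
  "bd_min_path_to B n v =
     (THE p. p \<in> (\<Pi>\<^sub>E j\<in>{1..<n}. bd_min_edges B j) \<and>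
        (\<forall>j. 1 \<le> j \<and> j + 1 < n \<longrightarrow> bd_rng B (p j) = bd_src B (p (j + 1))) \<and>
        (n > 1 \<longrightarrow> bd_rng B (p (n - 1)) = v))"

definition vershik_map :: "('v, 'e) bratteli \<Rightarrow> (nat \<Rightarrow> 'e) \<Rightarrow> (nat \<Rightarrow> 'e)" where
  "vershik_map B \<xi> =
     (let n = (LEAST n. n \<ge> 1 \<and> \<xi> n \<notin> bd_max_edges B n);
          g = bd_succ B (\<xi> n);
          p = bd_min_path_to B n (bd_src B g)
      in (\<lambda>j. if 1 \<le> j \<and> j < n then p j else if j = n then g else \<xi> j))"

definition vershik_action :: "('v, 'e) bratteli \<Rightarrow> (nat \<Rightarrow> 'e) zaction" where
  "vershik_action B =
     partial_action (bd_path_space B) (bd_paths B - bd_max_paths B) (bd_paths B - bd_min_paths B)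
       (vershik_map B)"


section \<open>The diagram of a sequence of Kakutani-Rokhlin partitions\<close>

definition kr_edges ::
  "(nat \<Rightarrow> nat) \<Rightarrow> (nat \<Rightarrow> nat \<Rightarrow> nat) \<Rightarrow> (nat \<Rightarrow> nat \<Rightarrow> nat \<Rightarrow> 'a set) \<Rightarrow>
   nat \<Rightarrow> (nat \<times> nat \<times> nat \<times> nat) set" where
  "kr_edges K J E n =
     {(n, m, k, j') | m k j'. n \<ge> 1 \<and> m \<in> {1..K (n - 1)} \<and> k \<in> {1..K n} \<and>
        j' + J (n - 1) m \<le> J n k \<and>
        (\<forall>j\<in>{1..J (n - 1) m}. E n k (j + j') \<subseteq> E (n - 1) m j)}"

definition kr_diagram ::
  "(nat \<Rightarrow> nat) \<Rightarrow> (nat \<Rightarrow> nat \<Rightarrow> nat) \<Rightarrow> (nat \<Rightarrow> nat \<Rightarrow> nat \<Rightarrow> 'a set) \<Rightarrow>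
   (nat \<times> nat, nat \<times> nat \<times> nat \<times> nat) bratteli" where
  "kr_diagram K J E =
     \<lparr> bd_verts = (\<lambda>n. {(n, k) | k. k \<in> {1..K n}}),
       bd_edges = kr_edges K J E,
       bd_rng = (\<lambda>(n, m, k, j'). (n, k)),
       bd_src = (\<lambda>(n, m, k, j'). (n - 1, m)),
       bd_le = {((n, m\<^sub>2, k, j\<^sub>2), (n, m\<^sub>1, k, j\<^sub>1)) | n k m\<^sub>1 m\<^sub>2 j\<^sub>1 j\<^sub>2.
                  (n, m\<^sub>2, k, j\<^sub>2) \<in> kr_edges K J E n \<and> (n, m\<^sub>1, k, j\<^sub>1) \<in> kr_edges K J E n \<and>
                  j\<^sub>1 \<ge> j\<^sub>2} \<rparr>"

lemma kr_tower_climb: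
  assumes A: "admissible X U V h K J E"
    and k: "k \<in> {1..K (Suc n)}" and j: "1 \<le> j" "j \<le> J (Suc n) k"
    and m: "m \<in> {1..K n}" and i: "1 \<le> i"
    and sub: "E (Suc n) k j \<subseteq> E n m i"
  shows "i + t \<le> J n m \<Longrightarrow> j + t \<le> J (Suc n) k \<and> E (Suc n) k (j + t) \<subseteq> E n m (i + t)"
proof (induction t)
  case 0
  then show ?case using j sub by simp
next
  case (Suc t)
  have P1: "kr_partition X U V h (K (Suc n)) (J (Suc n)) (E (Suc n))"
    and P0: "kr_partition X U V h (K n) (J n) (E n)"
    and dec: "(\<Union>k\<in>{1..K (Suc n)}. E (Suc n) k 1) \<subseteq> (\<Union>k\<in>{1..K n}. E n k 1)"
    using A by (auto simp: admissible_def decseq_Suc_iff)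
  have IH: "j + t \<le> J (Suc n) k" "E (Suc n) k (j + t) \<subseteq> E n m (i + t)"
    using Suc by auto
  have up: "h ` E n m (i + t) = E n m (i + t + 1)"
    using P0 m i Suc.prems by (simp add: kr_partition_def)
  have "j + t \<noteq> J (Suc n) k"
  proof
    assume top: "j + t = J (Suc n) k"
    have "(k, j + t) \<in> kr_index (K (Suc n)) (J (Suc n))"
      using k j IH by (auto simp: kr_index_def)
    then obtain x where x: "x \<in> E (Suc n) k (j + t)" "x \<in> topspace X"
      using P1 unfolding kr_partition_def by (force dest: openin_subset)
    have xm: "x \<in> E n m (i + t)" using x IH by auto
    have dis: "E n m' j' \<inter> E n m'' j'' = {}"
      if "m' \<in> {1..K n}" "j' \<in> {1..J n m'}" "m'' \<in> {1..K n}" "j'' \<in> {1..J n m''}"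
         "(m', j') \<noteq> (m'', j'')" for m' j' m'' j''
    proof -
      have "disjoint_family_on (\<lambda>(k, j). E n k j) (kr_index (K n) (J n))"
        using P0 by (simp add: kr_partition_def)
      from disjoint_family_onD[OF this, of "(m', j')" "(m'', j'')"] that
      show ?thesis by (simp add: kr_index_def)
    qed
    have "x \<in> U"
    proof (rule ccontr)
      assume "x \<notin> U"
      then obtain m' where m': "m' \<in> {1..K n}" "x \<in> E n m' (J n m')"
        using P0 x(2) by (auto simp: kr_partition_def)
      have "J n m' \<ge> 1" using P0 m' by (simp add: kr_partition_def)
      then have "E n m (i + t) \<inter> E n m' (J n m') = {}"
        by (intro dis) (use m m' i Suc.prems in auto)
      then show False using xm m' by auto
    qed
    then have "h x \<in> (\<Union>k\<in>{1..K (Suc n)}. h ` (E (Suc n) k (J (Suc n) k) - (topspace X - U)))"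
      using x k top by auto
    then have "h x \<in> (\<Union>k\<in>{1..K (Suc n)}. E (Suc n) k 1)"
      using P1 unfolding kr_partition_def by blast
    then obtain m' where m': "m' \<in> {1..K n}" "h x \<in> E n m' 1"
      using dec by blast
    have "J n m' \<ge> 1" using P0 m' by (simp add: kr_partition_def)
    then have "E n m' 1 \<inter> E n m (i + t + 1) = {}"
      using dis[of m' 1 m "i + t + 1"] m m' i Suc.prems by auto
    then show False using m' up xm by auto
  qed
  with IH have lt: "j + t < J (Suc n) k" by simp
  have "h ` E (Suc n) k (j + t) = E (Suc n) k (j + t + 1)"
    using P1 k j lt by (simp add: kr_partition_def)
  then show ?case using up IH lt by (auto simp: image_subset_iff)
qed

lemma ordered_bratteli_kr_diagram:
  assumes A: "admissible X U V h K J E"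
  shows "ordered_bratteli (kr_diagram K J E)"
proof -
  have P: "kr_partition X U V h (K n) (J n) (E n)" for n
    using A unfolding admissible_def by blast
  have K1: "K n \<ge> 1" for n using P[of n] by (simp add: kr_partition_def)
  have J1: "J n k \<ge> 1" if "k \<in> {1..K n}" for n k
    using P[of n] that by (simp add: kr_partition_def)
  have ne: "E n k j \<noteq> {}" if "k \<in> {1..K n}" "j \<in> {1..J n k}" for n k j
    using P[of n] that by (auto simp: kr_partition_def kr_index_def)
  have dis: "m' = m'' \<and> j' = j''"
    if "m' \<in> {1..K n}" "j' \<in> {1..J n m'}" "m'' \<in> {1..K n}" "j'' \<in> {1..J n m''}"
      "x \<in> E n m' j'" "x \<in> E n m'' j''" for n m' j' m'' j'' x
  proof -
    have "disjoint_family_on (\<lambda>(k, j). E n k j) (kr_index (K n) (J n))"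
      using P[of n] by (simp add: kr_partition_def)
    from disjoint_family_onD[OF this, of "(m', j')" "(m'', j'')"] that
    show ?thesis by (auto simp: kr_index_def)
  qed
  have cov: "\<exists>k\<in>{1..K n}. \<exists>j\<in>{1..J n k}. x \<in> E n k j" if "x \<in> topspace X" for n x
  proof -
    have "(\<Union>(k, j) \<in> kr_index (K n) (J n). E n k j) = topspace X"
      using P[of n] by (simp add: kr_partition_def)
    then show ?thesis using that unfolding kr_index_def by blast
  qed
  have intop: "x \<in> topspace X" if "k \<in> {1..K n}" "j \<in> {1..J n k}" "x \<in> E n k j" for n k j x
  proof -
    have "(\<Union>(k, j) \<in> kr_index (K n) (J n). E n k j) = topspace X"
      using P[of n] by (simp add: kr_partition_def)
    then show ?thesis using that unfolding kr_index_def by blast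
  qed
  have fin: "\<exists>m\<in>{1..K n}. \<exists>i\<in>{1..J n m}. E (Suc n) k j \<subseteq> E n m i"
    if "k \<in> {1..K (Suc n)}" "j \<in> {1..J (Suc n) k}" for n k j
  proof -
    have "\<forall>(k, j) \<in> kr_index (K (Suc n)) (J (Suc n)).
        \<exists>(m, i) \<in> kr_index (K n) (J n). E (Suc n) k j \<subseteq> E n m i"
      using A by (simp add: admissible_def)
    then show ?thesis using that unfolding kr_index_def by blast
  qed
  have dec: "(\<Union>k\<in>{1..K (Suc n)}. E (Suc n) k 1) \<subseteq> (\<Union>k\<in>{1..K n}. E n k 1)" for n
    using A by (auto simp: admissible_def decseq_Suc_iff)
  have edge: "(Suc n, m, k, j - 1) \<in> kr_edges K J E (Suc n)"
    if "k \<in> {1..K (Suc n)}" "j \<in> {1..J (Suc n) k}" "m \<in> {1..K n}"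
      "E (Suc n) k j \<subseteq> E n m 1" for n m k j
  proof -
    have climb: "j + t \<le> J (Suc n) k \<and> E (Suc n) k (j + t) \<subseteq> E n m (1 + t)"
      if "1 + t \<le> J n m" for t
      by (rule kr_tower_climb[OF A _ _ _ _ _ _ that]) (use \<open>k \<in> _\<close> \<open>j \<in> _\<close> \<open>m \<in> _\<close> \<open>E (Suc n) k j \<subseteq> _\<close> in auto)
    have "E (Suc n) k (i + (j - 1)) \<subseteq> E n m i" if "i \<in> {1..J n m}" for i
      using climb[of "i - 1"] that \<open>j \<in> _\<close> by (simp add: add.commute)
    moreover have "j - 1 + J n m \<le> J (Suc n) k"
      using climb[of "J n m - 1"] J1[OF \<open>m \<in> _\<close>] \<open>j \<in> _\<close> by simp
    ultimately show ?thesis using that by (auto simp: kr_edges_def)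
  qed
  have R: "\<exists>m j'. (Suc n, m, k, j') \<in> kr_edges K J E (Suc n)" if k: "k \<in> {1..K (Suc n)}" for n k
  proof -
    have J: "1 \<in> {1..J (Suc n) k}" using J1[OF k] by simp
    obtain m i where m: "m \<in> {1..K n}" "i \<in> {1..J n m}" "E (Suc n) k 1 \<subseteq> E n m i"
      using fin[OF k J] by blast
    obtain x where x: "x \<in> E (Suc n) k 1" using ne[OF k J] by blast
    then obtain m' where m': "m' \<in> {1..K n}" "x \<in> E n m' 1" using dec[of n] k by blast
    have "i = 1" using dis[OF m(1,2) m'(1) _ _ m'(2)] x m(3) J1[OF m'(1)] by auto
    then show ?thesis using edge[OF k J m(1)] m(3) by blast
  qed
  have S: "\<exists>k j'. (Suc n, m, k, j') \<in> kr_edges K J E (Suc n)" if m: "m \<in> {1..K n}" for n m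
  proof -
    have J: "1 \<in> {1..J n m}" using J1[OF m] by simp
    obtain x where x: "x \<in> E n m 1" using ne[OF m J] by blast
    obtain k j where k: "k \<in> {1..K (Suc n)}" "j \<in> {1..J (Suc n) k}" "x \<in> E (Suc n) k j"
      using cov[OF intop[OF m J x]] by blast
    obtain m' i where m': "m' \<in> {1..K n}" "i \<in> {1..J n m'}" "E (Suc n) k j \<subseteq> E n m' i"
      using fin[OF k(1,2)] by blast
    have "m' = m \<and> i = 1" using dis[OF m'(1,2) m J _ x] k m' by auto
    then show ?thesis using edge[OF k(1,2) m] m' by blast
  qed
  have anti: "m1 = m2" if "(n, m1, k, j) \<in> kr_edges K J E n" "(n, m2, k, j) \<in> kr_edges K J E n"
    for n m1 m2 k j
  proof -
    have m: "n \<ge> 1" "m1 \<in> {1..K (n-1)}" "m2 \<in> {1..K (n-1)}" "k \<in> {1..K n}" "j + J (n-1) m1 \<le> J n k"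
      "\<forall>i\<in>{1..J (n-1) m1}. E n k (i + j) \<subseteq> E (n-1) m1 i"
      "\<forall>i\<in>{1..J (n-1) m2}. E n k (i + j) \<subseteq> E (n-1) m2 i"
      using that by (auto simp: kr_edges_def)
    have J: "1 \<in> {1..J (n-1) m1}" "1 \<in> {1..J (n-1) m2}" using J1 m by auto
    have "1 + j \<in> {1..J n k}" using m(5) J by auto
    then obtain x where "x \<in> E n k (1 + j)" using ne m(4) by blast
    then show ?thesis using dis[OF m(2) J(1) m(3) J(2)] m J by blast
  qed
  have fE: "finite (kr_edges K J E n)" for n
  proof (rule finite_subset)
    show "kr_edges K J E n \<subseteq> {n} \<times> {1..K (n-1)} \<times> (SIGMA k:{1..K n}. {0..J n k})"
      by (auto simp: kr_edges_def)
  qed auto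
  have neE: "kr_edges K J E (Suc n) \<noteq> {}" for n using R[of 1 n] K1[of "Suc n"] by auto
  have rngE: "(\<lambda>(n, m, k, j'). (n, k)) ` kr_edges K J E (Suc n) = {(Suc n, k) | k. k \<in> {1..K (Suc n)}}" for n
  proof
    show "{(Suc n, k) | k. k \<in> {1..K (Suc n)}} \<subseteq> (\<lambda>(n, m, k, j'). (n, k)) ` kr_edges K J E (Suc n)"
      using R by (force simp: image_iff)
  qed (auto simp: kr_edges_def)
  have srcE: "(\<lambda>(n, m, k, j'). (n - 1, m)) ` kr_edges K J E (Suc n) = {(n, k) | k. k \<in> {1..K n}}" for n
  proof
    show "{(n, k) | k. k \<in> {1..K n}} \<subseteq> (\<lambda>(n, m, k, j'). (n - 1, m)) ` kr_edges K J E (Suc n)"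
      using S by (force simp: image_iff)
  qed (auto simp: kr_edges_def)
  have lev: "(\<forall>n\<ge>1. Q n) \<longleftrightarrow> (\<forall>n. Q (Suc n))" for Q :: "nat \<Rightarrow> bool"
    by (auto simp: Suc_le_eq gr0_conv_Suc)
  have K0: "K 0 = 1" using A by (simp add: admissible_def)
  let ?B = "kr_diagram K J E"
  have all: "bd_all_edges ?B = (\<Union>n. kr_edges K J E n)"
    by (auto simp: bd_all_edges_def kr_diagram_def kr_edges_def)
  have edge_lev: "(n', m, k, j) \<in> kr_edges K J E n \<Longrightarrow> (n', m, k, j) \<in> kr_edges K J E n'" for n n' m k j
    by (auto simp: kr_edges_def)
  have po: "partial_order_on (bd_all_edges ?B) (bd_le ?B)"
    unfolding all partial_order_on_def preorder_on_def
  proof (intro conjI)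
    show "refl_on (\<Union>n. kr_edges K J E n) (bd_le ?B)"
      by (auto simp: refl_on_def kr_diagram_def intro: edge_lev)
    show "trans (bd_le ?B)"
      by (auto simp: trans_def kr_diagram_def)
    show "antisym (bd_le ?B)"
      by (auto simp: antisym_def kr_diagram_def dest: anti)
    show "bd_le ?B \<subseteq> (\<Union>n. kr_edges K J E n) \<times> (\<Union>n. kr_edges K J E n)"
      by (auto simp: kr_diagram_def)
  qed
  show ?thesis
    unfolding ordered_bratteli_def
  proof (intro conjI)
    show "\<exists>v0. bd_verts ?B 0 = {v0}" by (rule exI[of _ "(0, 1)"]) (auto simp: kr_diagram_def K0)
    show "\<forall>n. finite (bd_verts ?B n) \<and> bd_verts ?B n \<noteq> {}"
      using K1 by (auto simp: kr_diagram_def)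
    show "\<forall>n\<ge>1. finite (bd_edges ?B n) \<and> bd_edges ?B n \<noteq> {}"
      unfolding lev using fE neE by (auto simp: kr_diagram_def)
    show "disjoint_family (bd_verts ?B)"
      by (auto simp: kr_diagram_def disjoint_family_on_def)
    show "disjoint_family_on (bd_edges ?B) {1..}"
      by (auto simp: kr_diagram_def disjoint_family_on_def kr_edges_def)
    show "\<forall>n\<ge>1. bd_rng ?B ` bd_edges ?B n = bd_verts ?B n \<and>
             bd_src ?B ` bd_edges ?B n = bd_verts ?B (n - 1)"
      unfolding lev using rngE srcE by (simp add: kr_diagram_def)
    show "\<forall>n. \<forall>v \<in> bd_verts ?B n. \<exists>e \<in> bd_all_edges ?B. bd_src ?B e = v"
    proof (intro allI ballI)
      fix n v assume "v \<in> bd_verts ?B n"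
      then obtain m where m: "m \<in> {1..K n}" "v = (n, m)" by (auto simp: kr_diagram_def)
      obtain k j' where "(Suc n, m, k, j') \<in> kr_edges K J E (Suc n)" using S[OF m(1)] by blast
      then have "(Suc n, m, k, j') \<in> bd_all_edges ?B" unfolding all by blast
      moreover have "bd_src ?B (Suc n, m, k, j') = v" by (simp add: kr_diagram_def m)
      ultimately show "\<exists>e \<in> bd_all_edges ?B. bd_src ?B e = v" by blast
    qed
    show "\<forall>n\<ge>1. \<forall>v \<in> bd_verts ?B n. bd_in_edges ?B v \<noteq> {}"
      unfolding lev
    proof (intro allI ballI)
      fix n v assume "v \<in> bd_verts ?B (Suc n)"
      then obtain k where k: "k \<in> {1..K (Suc n)}" "v = (Suc n, k)" by (auto simp: kr_diagram_def)
      obtain m j' where "(Suc n, m, k, j') \<in> kr_edges K J E (Suc n)" using R[OF k(1)] by blast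
      then have "(Suc n, m, k, j') \<in> bd_all_edges ?B" unfolding all by blast
      moreover have "bd_rng ?B (Suc n, m, k, j') = v" by (simp add: kr_diagram_def k)
      ultimately show "bd_in_edges ?B v \<noteq> {}" unfolding bd_in_edges_def by blast
    qed
    show "partial_order_on (bd_all_edges ?B) (bd_le ?B)" by (rule po)
    show "\<forall>e \<in> bd_all_edges ?B. \<forall>e' \<in> bd_all_edges ?B.
        (e, e') \<in> bd_le ?B \<or> (e', e) \<in> bd_le ?B \<longleftrightarrow> bd_rng ?B e = bd_rng ?B e'"
      unfolding all by (auto simp: kr_diagram_def intro: edge_lev)
  qed
qed

end

theory Submission
  imports Defs
begin

text \<open>
  A point \<open>x\<close> lies on exactly one floor \<open>E n (tow n x) (flr n x)\<close> of each partition. Since \<open>h\<close> moves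
  floors up one step and bases are nested, a tower of level \<open>n\<close> that \<open>x\<close> visits is traversed in full by
  the tower of level \<open>n + 1\<close> containing \<open>x\<close>, so the pairs of consecutive towers with the offsets
  \<open>flr (n + 1) x - flr n x\<close> form a path. Compactness makes every path the itinerary of a point, and
  the partitions separate points, so the itinerary map is a continuous bijection from a compact to a
  Hausdorff space. An edge is maximal iff its block of floors ends at the roof, minimal iff its offset
  is \<open>0\<close>, and otherwise its successor starts where its block ends. If \<open>N\<close> is the first level at which
  \<open>x\<close> is not on a roof, \<open>h x\<close> is on a base at all levels below \<open>N\<close> and one floor higher from \<open>N\<close> on,
  which is the rule defining the Vershik map.
\<close>

section \<open>Conjugate partial homeomorphisms\<close>

lemma funpow_conjugate:
  assumes "\<And>x. x \<in> D \<Longrightarrow> \<phi> (f x) = g (\<phi> x)" and "\<forall>i<n. (f ^^ i) x \<in> D"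
  shows "\<phi> ((f ^^ n) x) = (g ^^ n) (\<phi> x)"
  using assms(2) by (induction n) (auto simp: assms(1))

lemma iterate_dom_conjugate:
  assumes "\<phi> ` S \<subseteq> S'" and "\<phi> ` D \<subseteq> D'" and conj: "\<And>x. x \<in> D \<Longrightarrow> \<phi> (f x) = g (\<phi> x)"
  shows "\<phi> ` iterate_dom S D f n \<subseteq> iterate_dom S' D' g n"
proof clarify
  fix x assume x: "x \<in> iterate_dom S D f n"
  then have dom: "\<forall>i<n. (f ^^ i) x \<in> D" by (simp add: iterate_dom_def)
  have "(g ^^ i) (\<phi> x) \<in> D'" if "i < n" for i
  proof -
    have "\<phi> ((f ^^ i) x) = (g ^^ i) (\<phi> x)"
      by (rule funpow_conjugate[of D]) (use dom that conj in auto)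
    then show ?thesis using dom that assms(2) by (metis image_subset_iff)
  qed
  then show "\<phi> x \<in> iterate_dom S' D' g n"
    using x assms(1) by (auto simp: iterate_dom_def)
qed

text \<open>Integer powers split by sign into iterates of \<open>h\<close> on \<open>U\<close> and
  of its inverse on \<open>V\<close>. The two intertwining conditions therefore play the same role,
  each with its own domain.\<close>

lemma action_morphism_conjugate:
  assumes cont: "continuous_map X Y \<phi>"
    and U: "\<phi> ` U \<subseteq> U'" and V: "\<phi> ` V \<subseteq> V'"
    and h: "\<And>x. x \<in> U \<Longrightarrow> \<phi> (h x) = g (\<phi> x)"
    and hinv: "\<And>y. y \<in> V \<Longrightarrow> \<phi> (inv_into U h y) = inv_into U' g (\<phi> y)"
  shows "action_morphism (partial_action X U V h) (partial_action Y U' V' g) \<phi>"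
proof -
  have S: "\<phi> ` topspace X \<subseteq> topspace Y"
    using cont by (simp add: continuous_map_image_subset_topspace)
  have dom: "\<phi> ` zpower_dom (topspace X) U V h n \<subseteq> zpower_dom (topspace Y) U' V' g n" for n
    unfolding zpower_dom_def
    using iterate_dom_conjugate[where f = h and g = g, OF S U h]
      iterate_dom_conjugate[where f = "inv_into U h" and g = "inv_into U' g", OF S V hinv]
    by simp
  have map: "zpower U' g n (\<phi> x) = \<phi> (zpower U h n x)"
    if "x \<in> zpower_dom (topspace X) U V h n" for n x
    using that funpow_conjugate[of U \<phi> h g, OF h]
      funpow_conjugate[of V \<phi> "inv_into U h" "inv_into U' g", OF hinv]
    by (auto simp: zpower_dom_def zpower_def iterate_dom_def)
  show ?thesis
    using cont dom map by (simp add: action_morphism_def partial_action_def)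
qed

text \<open>Intertwining on \<open>U\<close> suffices: since \<open>\<phi>\<close> is bijective and
  carries \<open>U\<close> onto \<open>U'\<close>, both injectivity of \<open>g\<close> on
  \<open>U'\<close> and the relation between the inverses are inherited from \<open>h\<close>. The
  inverse of \<open>\<phi>\<close> then intertwines in the other direction.\<close>

lemma isomorphic_actions_conjugate:
  assumes homeo: "homeomorphic_map X Y \<phi>"
    and "U \<subseteq> topspace X" and "V \<subseteq> topspace X" and bij: "bij_betw h U V"
    and U: "\<phi> ` U = U'" and V: "\<phi> ` V = V'"
    and h: "\<And>x. x \<in> U \<Longrightarrow> \<phi> (h x) = g (\<phi> x)"
  shows "isomorphic_actions (partial_action X U V h) (partial_action Y U' V' g)"
proof -
  obtain \<psi> where maps: "homeomorphic_maps X Y \<phi> \<psi>"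
    using homeo homeomorphic_map_maps by blast
  then have \<phi>: "continuous_map X Y \<phi>" and \<psi>: "continuous_map Y X \<psi>"
    and \<psi>\<phi>: "\<And>x. x \<in> topspace X \<Longrightarrow> \<psi> (\<phi> x) = x" and \<phi>\<psi>: "\<And>y. y \<in> topspace Y \<Longrightarrow> \<phi> (\<psi> y) = y"
    by (auto simp: homeomorphic_maps_def)
  have hV: "h x \<in> V" if "x \<in> U" for x using bij that by (auto simp: bij_betw_def)
  \<comment> \<open>Injectivity of \<open>g\<close> is not assumed but derived from that of
    \<open>h\<close>; it makes \<open>inv_into U' g\<close> a true inverse rather than a chosen
    preimage.\<close>
  have inj: "inj_on g U'"
  proof (rule inj_onI)
    fix a b assume "a \<in> U'" "b \<in> U'" "g a = g b"
    then obtain x y where xy: "x \<in> U" "y \<in> U" "a = \<phi> x" "b = \<phi> y" "\<phi> (h x) = \<phi> (h y)"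
      using U h by auto
    then have "h x = h y" using \<psi>\<phi> hV assms(3) by (metis subsetD)
    then show "a = b" using xy bij by (auto simp: bij_betw_def dest: inj_onD)
  qed
  have hinv: "\<phi> (inv_into U h y) = inv_into U' g (\<phi> y)" if "y \<in> V" for y
  proof -
    obtain x where x: "x \<in> U" "y = h x"
      using bij_betw_imp_surj_on[OF bij] \<open>y \<in> V\<close> by blast
    then have "inv_into U h y = x" using bij by (simp add: bij_betw_def)
    moreover have "inv_into U' g (\<phi> y) = \<phi> x"
      using x h inj U by (metis imageI inv_into_f_f)
    ultimately show ?thesis by simp
  qed
  have ivU: "inv_into U h y \<in> U" if "y \<in> V" for y
    using bij that by (metis bij_betw_imp_surj_on inv_into_into)
  have "action_morphism (partial_action X U V h) (partial_action Y U' V' g) \<phi>"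
    by (rule action_morphism_conjugate) (use \<phi> U V h hinv in auto)
  moreover have "action_morphism (partial_action Y U' V' g) (partial_action X U V h) \<psi>"
  proof (rule action_morphism_conjugate[OF \<psi>])
    show "\<psi> ` U' \<subseteq> U" "\<psi> ` V' \<subseteq> V" using U V \<psi>\<phi> assms(2,3) by (auto simp: subset_iff)
    show "\<psi> (g x) = h (\<psi> x)" if "x \<in> U'" for x
      using that U h \<psi>\<phi> hV assms(2,3) by (smt (verit) image_iff subsetD)
    show "\<psi> (inv_into U' g y) = inv_into U h (\<psi> y)" if "y \<in> V'" for y
      using that V hinv \<psi>\<phi> ivU assms(2,3) by (smt (verit) image_iff subsetD)
  qed
  ultimately show ?thesis
    unfolding isomorphic_actions_def using \<psi>\<phi> \<phi>\<psi> by (auto simp: partial_action_def)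
qed

section \<open>Coordinates with respect to a Kakutani-Rokhlin sequence\<close>

text \<open>Compactness and the Hausdorff property are what the Cantor set contributes: the first
  puts a point on every path, the second separates points with different positions.\<close>

locale kr_sequence =
  fixes X :: "'a topology" and U V :: "'a set" and h :: "'a \<Rightarrow> 'a"
    and K :: "nat \<Rightarrow> nat" and J :: "nat \<Rightarrow> nat \<Rightarrow> nat" and E :: "nat \<Rightarrow> nat \<Rightarrow> nat \<Rightarrow> 'a set"
  assumes compact: "compact_space X" and Hausdorff: "Hausdorff_space X"
    and U_sub: "U \<subseteq> topspace X" and V_sub: "V \<subseteq> topspace X"
    and bij: "bij_betw h U V"
    and adm: "admissible X U V h K J E"
begin

abbreviation B where "B \<equiv> kr_diagram K J E"

lemma part: "kr_partition X U V h (K n) (J n) (E n)"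
  using adm unfolding admissible_def by blast

lemma level_zero: "K 0 = 1" "J 0 (Suc 0) = 1" "E 0 (Suc 0) (Suc 0) = topspace X"
  using adm by (simp_all add: admissible_def)

lemma J_pos: "k \<in> {1..K n} \<Longrightarrow> 1 \<le> J n k"
  using part[of n] by (simp add: kr_partition_def)

lemma floor_nonempty: "k \<in> {1..K n} \<Longrightarrow> j \<in> {1..J n k} \<Longrightarrow> E n k j \<noteq> {}"
  and floor_open: "k \<in> {1..K n} \<Longrightarrow> j \<in> {1..J n k} \<Longrightarrow> openin X (E n k j)"
  and floor_closed: "k \<in> {1..K n} \<Longrightarrow> j \<in> {1..J n k} \<Longrightarrow> closedin X (E n k j)"
  using part[of n] by (auto simp: kr_partition_def kr_index_def)

lemma floor_cover: "x \<in> topspace X \<Longrightarrow> \<exists>k\<in>{1..K n}. \<exists>j\<in>{1..J n k}. x \<in> E n k j"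
proof -
  have "(\<Union>(k, j) \<in> kr_index (K n) (J n). E n k j) = topspace X"
    using part[of n] by (simp add: kr_partition_def)
  then show "x \<in> topspace X \<Longrightarrow> ?thesis" unfolding kr_index_def by blast
qed

lemma floor_unique:
  assumes "k \<in> {1..K n}" "j \<in> {1..J n k}" "x \<in> E n k j"
    and "k' \<in> {1..K n}" "j' \<in> {1..J n k'}" "x \<in> E n k' j'"
  shows "k' = k \<and> j' = j"
proof -
  have "disjoint_family_on (\<lambda>(k, j). E n k j) (kr_index (K n) (J n))"
    using part[of n] by (simp add: kr_partition_def)
  from disjoint_family_onD[OF this, of "(k, j)" "(k', j')"] assms
  show ?thesis by (auto simp: kr_index_def)
qed

lemma base_decreasing: "(\<Union>k\<in>{1..K (Suc n)}. E (Suc n) k 1) \<subseteq> (\<Union>k\<in>{1..K n}. E n k 1)"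
  using adm by (auto simp: admissible_def decseq_Suc_iff)

lemma floor_refines:
  assumes "k \<in> {1..K (Suc n)}" "j \<in> {1..J (Suc n) k}"
  shows "\<exists>m\<in>{1..K n}. \<exists>i\<in>{1..J n m}. E (Suc n) k j \<subseteq> E n m i"
proof -
  have "\<forall>(k, j) \<in> kr_index (K (Suc n)) (J (Suc n)).
      \<exists>(m, i) \<in> kr_index (K n) (J n). E (Suc n) k j \<subseteq> E n m i"
    using adm by (simp add: admissible_def)
  then show ?thesis using assms unfolding kr_index_def by blast
qed

text \<open>Together with \<open>flr\<close> this is the address of a point at level
  \<open>n\<close>; both descriptions denote something only for points of the space.\<close>

definition tow :: "nat \<Rightarrow> 'a \<Rightarrow> nat" where
  "tow n x = (THE k. k \<in> {1..K n} \<and> (\<exists>j\<in>{1..J n k}. x \<in> E n k j))"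

definition flr :: "nat \<Rightarrow> 'a \<Rightarrow> nat" where
  "flr n x = (THE j. j \<in> {1..J n (tow n x)} \<and> x \<in> E n (tow n x) j)"

lemma coordinates_eq:
  assumes "k \<in> {1..K n}" "j \<in> {1..J n k}" "x \<in> E n k j"
  shows "tow n x = k" "flr n x = j"
proof -
  show t: "tow n x = k"
    unfolding tow_def by (rule the_equality) (use assms floor_unique in blast)+
  show "flr n x = j"
    unfolding flr_def t by (rule the_equality) (use assms floor_unique in blast)+
qed

lemma coordinates:
  assumes "x \<in> topspace X"
  shows tow_range: "tow n x \<in> {1..K n}" and flr_range: "flr n x \<in> {1..J n (tow n x)}"
    and in_floor: "x \<in> E n (tow n x) (flr n x)"
proof -
  obtain k j where "k \<in> {1..K n}" "j \<in> {1..J n k}" "x \<in> E n k j"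
    using floor_cover[OF assms] by blast
  with coordinates_eq[OF this]
  show "tow n x \<in> {1..K n}" "flr n x \<in> {1..J n (tow n x)}" "x \<in> E n (tow n x) (flr n x)" by auto
qed

lemma floor_in_space: "k \<in> {1..K n} \<Longrightarrow> j \<in> {1..J n k} \<Longrightarrow> E n k j \<subseteq> topspace X"
  by (rule openin_subset[OF floor_open])

text \<open>Refinement only says that some coarser floor contains the finer one; since that floor
  contains \<open>x\<close>, it must be the one at the coordinates of \<open>x\<close>.\<close>

lemma floor_nested: "x \<in> topspace X \<Longrightarrow>
  E (Suc n) (tow (Suc n) x) (flr (Suc n) x) \<subseteq> E n (tow n x) (flr n x)"
  using floor_refines[OF tow_range flr_range, of x n] in_floor[of x "Suc n"] coordinates_eq[of _ n _ x]
  by blast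

lemma level_zero_coordinates: "x \<in> topspace X \<Longrightarrow> tow 0 x = 1 \<and> flr 0 x = 1"
  using coordinates_eq[of 1 0 1 x] level_zero by simp

lemma top_if_not_U:
  assumes "x \<in> topspace X - U"
  shows "flr n x = J n (tow n x)"
proof -
  have "x \<in> (\<Union>k\<in>{1..K n}. E n k (J n k))"
    using part[of n] assms unfolding kr_partition_def by blast
  then obtain k where k: "k \<in> {1..K n}" "x \<in> E n k (J n k)" by blast
  then show ?thesis using coordinates_eq[OF k(1) _ k(2)] J_pos[OF k(1)] by simp
qed

lemma h_up:
  assumes "x \<in> topspace X" and lt: "flr n x < J n (tow n x)"
  shows "x \<in> U" "tow n (h x) = tow n x" "flr n (h x) = Suc (flr n x)"
proof -
  show "x \<in> U" using top_if_not_U[of x n] assms by auto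
  have "h ` E n (tow n x) (flr n x) = E n (tow n x) (flr n x + 1)"
    using part[of n] lt tow_range[OF assms(1), of n] flr_range[OF assms(1), of n]
    by (simp add: kr_partition_def)
  then have "h x \<in> E n (tow n x) (Suc (flr n x))" using in_floor[OF assms(1), of n] by auto
  then show "tow n (h x) = tow n x" "flr n (h x) = Suc (flr n x)"
    using coordinates_eq[of "tow n x" n "Suc (flr n x)" "h x"] lt tow_range[OF assms(1), of n] by auto
qed

lemma base_iff:
  assumes "x \<in> topspace X"
  shows "x \<in> (\<Union>k\<in>{1..K n}. E n k 1) \<longleftrightarrow> flr n x = 1"
proof
  assume "flr n x = 1"
  then show "x \<in> (\<Union>k\<in>{1..K n}. E n k 1)"
    using tow_range[OF assms, of n] in_floor[OF assms, of n] by auto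
next
  assume "x \<in> (\<Union>k\<in>{1..K n}. E n k 1)"
  then obtain k where k: "k \<in> {1..K n}" "x \<in> E n k 1" by blast
  then show "flr n x = 1" using coordinates_eq[OF k(1) _ k(2)] J_pos[OF k(1)] by simp
qed

lemma h_in: "x \<in> U \<Longrightarrow> h x \<in> V" "x \<in> U \<Longrightarrow> h x \<in> topspace X"
  using bij V_sub by (auto simp: bij_betw_def)

text \<open>Condition (3) of a Kakutani-Rokhlin partition: roofs, where \<open>h\<close> is defined,
  map into bases. The tower reached is left open.\<close>

lemma h_wrap:
  assumes "x \<in> U" and top: "flr n x = J n (tow n x)"
  shows "flr n (h x) = 1"
proof -
  have x: "x \<in> topspace X" using assms U_sub by blast
  have "h x \<in> (\<Union>k\<in>{1..K n}. h ` (E n k (J n k) - (topspace X - U)))"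
    using in_floor[OF x, of n] tow_range[OF x, of n] assms by auto
  then have "h x \<in> (\<Union>k\<in>{1..K n}. E n k 1)" using part[of n] unfolding kr_partition_def by blast
  then show ?thesis using base_iff h_in assms by blast
qed

lemma not_V_iff:
  assumes "x \<in> topspace X"
  shows "x \<notin> V \<longleftrightarrow> (\<forall>n. flr n x = 1)"
proof -
  have "(\<Inter>n. \<Union>k\<in>{1..K n}. E n k 1) = topspace X - V"
    using adm by (simp add: admissible_def)
  then show ?thesis using base_iff[OF assms] assms by blast
qed

text \<open>Admissibility describes only the intersection of the bases. For the roofs, a point of
  \<open>U\<close> on all of them would be sent by \<open>h\<close> onto all bases, hence outside
  \<open>V\<close>, which is impossible.\<close>

lemma not_U_iff:
  assumes "x \<in> topspace X"
  shows "x \<notin> U \<longleftrightarrow> (\<forall>n. flr n x = J n (tow n x))"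
proof
  show "x \<notin> U \<Longrightarrow> \<forall>n. flr n x = J n (tow n x)" using top_if_not_U assms by blast
  show "\<forall>n. flr n x = J n (tow n x) \<Longrightarrow> x \<notin> U"
    using h_wrap not_V_iff h_in by blast
qed

section \<open>Floor inclusions between consecutive levels and the edges they produce\<close>

lemma down_step:
  assumes k: "k \<in> {1..K (Suc n)}" "1 \<le> j" "j \<le> J (Suc n) k"
    and m: "m \<in> {1..K n}" "1 < i" "i \<le> J n m"
    and sub: "E (Suc n) k j \<subseteq> E n m i"
  shows "1 < j \<and> E (Suc n) k (j - 1) \<subseteq> E n m (i - 1)"
proof
  have j: "1 \<le> j" "j \<in> {1..J (Suc n) k}" using k by auto
  have i: "i \<in> {1..J n m}" using m by auto
  \<comment> \<open>A base floor of level \<open>Suc n\<close> lies in the union of the bases of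
    level \<open>n\<close>, whereas floor \<open>i\<close> is above the base.\<close>
  show j1: "1 < j"
  proof (rule ccontr)
    assume "\<not> 1 < j"
    then have "j = 1" using j by simp
    obtain x where x: "x \<in> E (Suc n) k j" using floor_nonempty[OF k(1) j(2)] by blast
    then have "x \<in> (\<Union>k\<in>{1..K n}. E n k 1)" using base_decreasing[of n] k(1) \<open>j = 1\<close> by blast
    then have "flr n x = 1" using base_iff floor_in_space[OF k(1) j(2)] x by blast
    moreover have "flr n x = i" using coordinates_eq[OF m(1) i] x sub by blast
    ultimately show False using m by simp
  qed
  show "E (Suc n) k (j - 1) \<subseteq> E n m (i - 1)"
  proof
    fix x assume x: "x \<in> E (Suc n) k (j - 1)"
    have r: "j - 1 \<in> {1..J (Suc n) k}" using j1 k by auto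
    have xS: "x \<in> topspace X" using floor_in_space[OF k(1) r] x by blast
    have c: "tow (Suc n) x = k" "flr (Suc n) x = j - 1" using coordinates_eq[OF k(1) r x] by auto
    have xU: "x \<in> U" and hx: "tow (Suc n) (h x) = k" "flr (Suc n) (h x) = j"
      using h_up[OF xS, of "Suc n"] c j1 k by auto
    have "h x \<in> E n m i" using in_floor[OF h_in(2)[OF xU], of "Suc n"] hx sub by auto
    then have hc: "tow n (h x) = m" "flr n (h x) = i" using coordinates_eq[OF m(1) i] by auto
    \<comment> \<open>On a roof of level \<open>n\<close>, \<open>x\<close> would be sent to floor
      \<open>1\<close>, but \<open>h x\<close> is on floor \<open>i > 1\<close>.\<close>
    then have "flr n x < J n (tow n x)"
      using h_wrap[OF xU, of n] m flr_range[OF xS, of n] by (metis atLeastAtMost_iff le_neq_implies_less less_irrefl)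
    then have "tow n x = m" "flr n x = i - 1" using h_up[OF xS, of n] hc by auto
    then show "x \<in> E n m (i - 1)" using in_floor[OF xS, of n] by simp
  qed
qed

text \<open>Downward counterpart of \<open>kr_tower_climb\<close>: an inclusion of floors persists
  until the base of the coarser tower is reached.\<close>

lemma descend:
  assumes k: "k \<in> {1..K (Suc n)}" "1 \<le> j" "j \<le> J (Suc n) k"
    and m: "m \<in> {1..K n}" "i \<le> J n m"
    and sub: "E (Suc n) k j \<subseteq> E n m i"
  shows "t < i \<Longrightarrow> t < j \<and> E (Suc n) k (j - t) \<subseteq> E n m (i - t)"
proof (induction t)
  case 0
  then show ?case using k sub by simp
next
  case (Suc t)
  then have "t < j" "E (Suc n) k (j - t) \<subseteq> E n m (i - t)" by auto
  then have "1 < j - t \<and> E (Suc n) k (j - t - 1) \<subseteq> E n m (i - t - 1)"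
    using k m Suc.prems by (intro down_step) auto
  then show ?case by auto
qed

text \<open>One inclusion yields a whole edge: descend \<open>i - 1\<close> floors to the base of
  tower \<open>m\<close>, then climb to its roof. The block so found starts right above floor
  \<open>j - i\<close>, which is the offset.\<close>

lemma edge_of_inclusion:
  assumes k: "k \<in> {1..K (Suc n)}" "j \<in> {1..J (Suc n) k}"
    and m: "m \<in> {1..K n}" "i \<in> {1..J n m}"
    and sub: "E (Suc n) k j \<subseteq> E n m i"
  shows "i \<le> j" "(Suc n, m, k, j - i) \<in> kr_edges K J E (Suc n)"
proof -
  have d: "i - 1 < j \<and> E (Suc n) k (j - (i - 1)) \<subseteq> E n m (i - (i - 1))"
    using assms by (intro descend) auto
  show ij: "i \<le> j" using d m by auto
  have climb: "j - (i - 1) + t \<le> J (Suc n) k \<and> E (Suc n) k (j - (i - 1) + t) \<subseteq> E n m (1 + t)"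
    if "1 + t \<le> J n m" for t
    by (rule kr_tower_climb[OF adm k(1) _ _ m(1) _ _ that]) (use d k m ij in auto)
  have "E (Suc n) k (s + (j - i)) \<subseteq> E n m s" if "s \<in> {1..J n m}" for s
  proof -
    have "j - (i - 1) + (s - 1) = s + (j - i)" "1 + (s - 1) = s" "s \<le> J n m" using ij that m by auto
    then show ?thesis using climb[of "s - 1"] by metis
  qed
  moreover have "j - i + J n m \<le> J (Suc n) k"
    using climb[of "J n m - 1"] J_pos[OF m(1)] ij m by simp
  ultimately show "(Suc n, m, k, j - i) \<in> kr_edges K J E (Suc n)"
    using k m by (simp add: kr_edges_def)
qed

lemma edgeD:
  assumes "(n', m, k, d) \<in> kr_edges K J E (Suc n)"
  shows "n' = Suc n" "m \<in> {1..K n}" "k \<in> {1..K (Suc n)}" "d + J n m \<le> J (Suc n) k"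
    and "\<And>i. i \<in> {1..J n m} \<Longrightarrow> E (Suc n) k (i + d) \<subseteq> E n m i"
  using assms by (auto simp: kr_edges_def)

text \<open>The edge occupies floors \<open>d + 1\<close> to \<open>d + J n m\<close> of tower
  \<open>k\<close>, and on this block the coarser address is read off by subtracting
  \<open>d\<close>.\<close>

lemma edge_coordinates:
  assumes e: "(Suc n, m, k, d) \<in> kr_edges K J E (Suc n)"
    and x: "x \<in> topspace X" "tow (Suc n) x = k" "d < flr (Suc n) x" "flr (Suc n) x \<le> d + J n m"
  shows "tow n x = m" "flr n x = flr (Suc n) x - d"
proof -
  let ?i = "flr (Suc n) x - d"
  have i: "?i \<in> {1..J n m}" using x by auto
  have "x \<in> E n m ?i" using edgeD(5)[OF e i] in_floor[OF x(1), of "Suc n"] x by auto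
  then show "tow n x = m" "flr n x = flr (Suc n) x - d" using coordinates_eq[OF edgeD(2)[OF e] i] by auto
qed

lemma point_at:
  assumes "k \<in> {1..K n}" "j \<in> {1..J n k}"
  obtains x where "x \<in> topspace X" "tow n x = k" "flr n x = j"
  using floor_nonempty[OF assms] coordinates_eq[OF assms] floor_in_space[OF assms] by blast

text \<open>Blocks of different edges into one tower do not overlap. A point on the first floor
  \<open>Suc d'\<close> of the second block is on floor \<open>1\<close> of tower \<open>m'\<close>;
  if it is also in the first block, it is on floor \<open>Suc d' - d\<close> of tower
  \<open>m\<close>.\<close>

lemma edge_between:
  assumes e: "(Suc n, m, k, d) \<in> kr_edges K J E (Suc n)"
    and e': "(Suc n, m', k, d') \<in> kr_edges K J E (Suc n)"
    and "d \<le> d'" "d' < d + J n m"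
  shows "m' = m \<and> d' = d"
proof -
  have "1 \<le> J n m'" using J_pos[OF edgeD(2)[OF e']] .
  then have "Suc d' \<in> {1..J (Suc n) k}" using edgeD(4)[OF e'] by simp
  then obtain x where x: "x \<in> topspace X" "tow (Suc n) x = k" "flr (Suc n) x = Suc d'"
    using point_at[OF edgeD(3)[OF e]] by blast
  then show ?thesis
    using edge_coordinates[OF e x(1,2)] edge_coordinates[OF e' x(1,2)] assms(3,4) \<open>1 \<le> J n m'\<close> by auto
qed

text \<open>Apply \<open>h\<close> to a point on the last floor of the block: at level
  \<open>Suc n\<close> it rises by one, at level \<open>n\<close> it passes from roof to base, so a
  new block begins there.\<close>

lemma next_edge:
  assumes e: "(Suc n, m, k, d) \<in> kr_edges K J E (Suc n)" and lt: "d + J n m < J (Suc n) k"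
  obtains m' where "(Suc n, m', k, d + J n m) \<in> kr_edges K J E (Suc n)"
proof -
  have m: "1 \<le> J n m" using J_pos[OF edgeD(2)[OF e]] .
  then have "d + J n m \<in> {1..J (Suc n) k}" using lt by auto
  then obtain x where x: "x \<in> topspace X" "tow (Suc n) x = k" "flr (Suc n) x = d + J n m"
    using point_at[OF edgeD(3)[OF e]] by blast
  have "tow n x = m" "flr n x = J n m" using edge_coordinates[OF e x(1,2)] x(3) m by auto
  moreover have hx: "x \<in> U" "tow (Suc n) (h x) = k" "flr (Suc n) (h x) = Suc (d + J n m)"
    using h_up[OF x(1), of "Suc n"] x lt by auto
  ultimately have b: "flr n (h x) = 1" using h_wrap by simp
  note y = h_in(2)[OF hx(1)]
  have "(Suc n, tow n (h x), k, d + J n m) \<in> kr_edges K J E (Suc n)"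
    using edge_of_inclusion(2)[OF tow_range[OF y] flr_range[OF y] tow_range[OF y] flr_range[OF y] floor_nested[OF y], of n]
    by (simp add: hx b)
  then show thesis by (rule that)
qed

section \<open>Maximal, minimal and successor edges\<close>

lemma in_edges_iff: "e \<in> bd_in_edges B (Suc n, k) \<longleftrightarrow>
    (\<exists>m d. e = (Suc n, m, k, d) \<and> (Suc n, m, k, d) \<in> kr_edges K J E (Suc n))"
  by (auto simp: bd_in_edges_def bd_all_edges_def kr_diagram_def kr_edges_def)

lemma le_iff: "((Suc n, m, k, d), (Suc n, m', k, d')) \<in> bd_le B \<longleftrightarrow>
    (Suc n, m, k, d) \<in> kr_edges K J E (Suc n) \<and> (Suc n, m', k, d') \<in> kr_edges K J E (Suc n) \<and> d \<le> d'"
  by (auto simp: kr_diagram_def)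

lemma diagram_simps: "bd_edges B n = kr_edges K J E n" "bd_rng B (n, m, k, d) = (n, k)"
    "bd_src B (n, m, k, d) = (n - 1, m)"
  by (auto simp: kr_diagram_def)

lemma in_max_edges: "(Suc n, m, k, d) \<in> bd_max_edges B (Suc n) \<longleftrightarrow>
    (Suc n, m, k, d) \<in> kr_edges K J E (Suc n) \<and>
    (\<forall>m' d'. (Suc n, m', k, d') \<in> kr_edges K J E (Suc n) \<and> d \<le> d' \<longrightarrow> m' = m \<and> d' = d)"
  unfolding bd_max_edges_def mem_Collect_eq diagram_simps Ball_def in_edges_iff
  using le_iff by blast

lemma in_min_edges: "(Suc n, m, k, d) \<in> bd_min_edges B (Suc n) \<longleftrightarrow>
    (Suc n, m, k, d) \<in> kr_edges K J E (Suc n) \<and>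
    (\<forall>m' d'. (Suc n, m', k, d') \<in> kr_edges K J E (Suc n) \<and> d' \<le> d \<longrightarrow> m' = m \<and> d' = d)"
  unfolding bd_min_edges_def mem_Collect_eq diagram_simps Ball_def in_edges_iff
  using le_iff by blast

text \<open>A block ending below the roof is followed by a larger edge, from
  \<open>next_edge\<close>. Conversely, an edge starting at or after a block that ends at the roof
  must start inside it, so \<open>edge_between\<close> identifies the two.\<close>

lemma max_edge_iff:
  assumes e: "(Suc n, m, k, d) \<in> kr_edges K J E (Suc n)"
  shows "(Suc n, m, k, d) \<in> bd_max_edges B (Suc n) \<longleftrightarrow> d + J n m = J (Suc n) k"
proof
  assume mx: "(Suc n, m, k, d) \<in> bd_max_edges B (Suc n)"
  show "d + J n m = J (Suc n) k"
  proof (rule ccontr)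
    assume "d + J n m \<noteq> J (Suc n) k"
    then obtain m' where e': "(Suc n, m', k, d + J n m) \<in> kr_edges K J E (Suc n)"
      using next_edge[OF e] edgeD(4)[OF e] by (metis le_neq_implies_less)
    have "d + J n m = d" using mx[unfolded in_max_edges] e' le_add1 by blast
    then show False using J_pos[OF edgeD(2)[OF e]] by simp
  qed
next
  assume top: "d + J n m = J (Suc n) k"
  have "m' = m \<and> d' = d" if e': "(Suc n, m', k, d') \<in> kr_edges K J E (Suc n)" and "d \<le> d'" for m' d'
    using edge_between[OF e e' \<open>d \<le> d'\<close>] edgeD(4)[OF e'] J_pos[OF edgeD(2)[OF e']] top by linarith
  then show "(Suc n, m, k, d) \<in> bd_max_edges B (Suc n)"
    unfolding in_max_edges using e by blast
qed

text \<open>The block through the base of tower \<open>k\<close> supplies an edge with offset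
  \<open>0\<close>, which lies below every other edge into \<open>k\<close>.\<close>

lemma min_edge_iff:
  assumes e: "(Suc n, m, k, d) \<in> kr_edges K J E (Suc n)"
  shows "(Suc n, m, k, d) \<in> bd_min_edges B (Suc n) \<longleftrightarrow> d = 0"
proof
  assume mn: "(Suc n, m, k, d) \<in> bd_min_edges B (Suc n)"
  note k = edgeD(3)[OF e]
  have "1 \<in> {1..J (Suc n) k}" using J_pos[OF k] by simp
  then obtain x where x: "x \<in> topspace X" "tow (Suc n) x = k" "flr (Suc n) x = 1"
    using point_at[OF k] by blast
  have "(Suc n, tow n x, k, 1 - flr n x) \<in> kr_edges K J E (Suc n)"
    using edge_of_inclusion(2)[OF tow_range[OF x(1)] flr_range[OF x(1)] tow_range[OF x(1)] flr_range[OF x(1)] floor_nested[OF x(1)], of n]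
    by (simp add: x)
  \<comment> \<open>Floors are numbered from \<open>1\<close>, so this difference of naturals
    vanishes.\<close>
  moreover have "1 - flr n x = 0" using flr_range[OF x(1), of n] by simp
  ultimately have "(Suc n, tow n x, k, 0) \<in> kr_edges K J E (Suc n)" by simp
  then have "0 = d" using mn[unfolded in_min_edges] le0 by blast
  then show "d = 0" by simp
next
  assume "d = 0"
  have "m' = m \<and> d' = d" if e': "(Suc n, m', k, d') \<in> kr_edges K J E (Suc n)" and "d' \<le> d" for m' d'
    using edge_between[OF e e'] J_pos[OF edgeD(2)[OF e]] \<open>d = 0\<close> \<open>d' \<le> d\<close> by simp
  then show "(Suc n, m, k, d) \<in> bd_min_edges B (Suc n)"
    unfolding in_min_edges using e by blast
qed

lemma succ_edge:
  assumes e: "(Suc n, m, k, d) \<in> kr_edges K J E (Suc n)"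
    and g: "(Suc n, m', k, d + J n m) \<in> kr_edges K J E (Suc n)"
  shows "bd_succ B (Suc n, m, k, d) = (Suc n, m', k, d + J n m)"
proof -
  have J: "1 \<le> J n m" using J_pos[OF edgeD(2)[OF e]] .
  \<comment> \<open>By disjointness of blocks, a later edge cannot start before the present block
    ends.\<close>
  have least: "d + J n m \<le> d2"
    if "(Suc n, m2, k, d2) \<in> kr_edges K J E (Suc n)" "d \<le> d2" "(m2, d2) \<noteq> (m, d)" for m2 d2
    using edge_between[OF e that(1,2)] that(3) not_le by blast
  have anti: "m2 = m'" if "(Suc n, m2, k, d + J n m) \<in> kr_edges K J E (Suc n)" for m2
    using edge_between[OF g that] J_pos[OF edgeD(2)[OF g]] by simp
  show ?thesis
    unfolding bd_succ_def diagram_simps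
  proof (rule the_equality, goal_cases)
    case 1
    have "m2 = m" "d2 = d"
      if "(Suc n, m2, k, d2) \<in> kr_edges K J E (Suc n)" "d \<le> d2" "\<not> d + J n m \<le> d2" for m2 d2
      using least[of m2 d2] that by blast+
    then show ?case using e g J by (auto simp: in_edges_iff le_iff)
  next
    case (2 f)
    then obtain m2 d2 where f: "f = (Suc n, m2, k, d2)" "(Suc n, m2, k, d2) \<in> kr_edges K J E (Suc n)"
      by (auto simp: in_edges_iff)
    have "(Suc n, m', k, d + J n m) \<in> bd_in_edges B (Suc n, k)" using g by (simp add: in_edges_iff)
    moreover have "((Suc n, m, k, d), (Suc n, m', k, d + J n m)) \<in> bd_le B"
      using e g by (simp add: le_iff)
    moreover have "(Suc n, m', k, d + J n m) \<noteq> (Suc n, m, k, d)" using J by simp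
    ultimately have "(f, (Suc n, m', k, d + J n m)) \<in> bd_le B" using 2 by blast
    then have "d2 \<le> d + J n m" by (simp add: f(1) le_iff)
    moreover have "d + J n m \<le> d2" using 2 least[OF f(2)] f by (auto simp: le_iff)
    ultimately show ?case using f anti by auto
  qed
qed

lemma min_edge_unique:
  assumes "(Suc n, m, k, d) \<in> bd_min_edges B (Suc n)" "(Suc n, m', k, d') \<in> bd_min_edges B (Suc n)"
  shows "m = m' \<and> d = d'"
proof -
  have e: "(Suc n, m, k, d) \<in> kr_edges K J E (Suc n)" "(Suc n, m', k, d') \<in> kr_edges K J E (Suc n)"
    using assms by (auto simp: bd_min_edges_def diagram_simps)
  then have "d = 0" "d' = 0" using assms min_edge_iff by blast+
  then show ?thesis using edge_between[OF e] J_pos[OF edgeD(2)[OF e(1)]] by simp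
qed

section \<open>The path of a point\<close>

text \<open>Restriction to \<open>{1..}\<close> gives the value \<open>undefined\<close> at
  \<open>0\<close> that \<open>bd_paths\<close> demands. The last component is a genuine difference
  by \<open>flr_mono\<close>.\<close>

definition itinerary :: "'a \<Rightarrow> nat \<Rightarrow> nat \<times> nat \<times> nat \<times> nat" where
  "itinerary x = (\<lambda>n\<in>{1..}. (n, tow (n - 1) x, tow n x, flr n x - flr (n - 1) x))"

lemma itinerary_Suc [simp]:
  "itinerary x (Suc n) = (Suc n, tow n x, tow (Suc n) x, flr (Suc n) x - flr n x)"
  by (simp add: itinerary_def)

lemma itinerary_edge:
  assumes "x \<in> topspace X"
  shows "(Suc n, tow n x, tow (Suc n) x, flr (Suc n) x - flr n x) \<in> kr_edges K J E (Suc n)"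
    and flr_mono: "flr n x \<le> flr (Suc n) x"
  using edge_of_inclusion[OF tow_range flr_range tow_range flr_range floor_nested, OF assms assms assms assms assms]
  by auto

lemma all_pos_iff: "(\<forall>n\<ge>1. P n) \<longleftrightarrow> (\<forall>n. P (Suc n))"
  by (auto simp: Suc_le_eq gr0_conv_Suc)

lemma paths_iff: "\<xi> \<in> bd_paths B \<longleftrightarrow> \<xi> 0 = undefined \<and> (\<forall>n. \<xi> (Suc n) \<in> kr_edges K J E (Suc n)) \<and>
    (\<forall>n. bd_rng B (\<xi> (Suc n)) = bd_src B (\<xi> (Suc (Suc n))))"
proof -
  have "(\<forall>n. n \<notin> {1..} \<longrightarrow> \<xi> n = undefined) \<longleftrightarrow> \<xi> 0 = undefined" by (auto simp: not_le)
  moreover have "(\<forall>n\<in>{1..}. \<xi> n \<in> bd_edges B n) \<longleftrightarrow> (\<forall>n. \<xi> (Suc n) \<in> kr_edges K J E (Suc n))"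
    using all_pos_iff[of "\<lambda>n. \<xi> n \<in> kr_edges K J E n"] by (simp add: diagram_simps Ball_def)
  ultimately show ?thesis
    unfolding bd_paths_def PiE_iff extensional_def all_pos_iff mem_Collect_eq by auto
qed

lemma itinerary_path: "x \<in> topspace X \<Longrightarrow> itinerary x \<in> bd_paths B"
  using itinerary_edge(1) by (simp add: paths_iff diagram_simps) (simp add: itinerary_def)

lemma path_space_top: "topspace (bd_path_space B) = bd_paths B"
  by (auto simp: bd_path_space_def bd_paths_def)

text \<open>Each edge's block fits inside the larger tower, so the number of floors above
  \<open>x\<close> cannot decrease with the level. Once off the roof, a point stays off it at all
  later levels.\<close>

lemma roof_distance_mono:
  assumes "x \<in> topspace X" "n \<le> i"
  shows "J n (tow n x) - flr n x \<le> J i (tow i x) - flr i x"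
  using assms(2)
proof (induction rule: dec_induct)
  case (step i)
  then show ?case
    using edgeD(4)[OF itinerary_edge(1)[OF assms(1)], of i] flr_mono[OF assms(1), of i]
      flr_range[OF assms(1), of i] by auto
qed simp

text \<open>An edge of the itinerary is maximal iff the distance to the roof does not change across
  it. This distance is \<open>0\<close> at level \<open>0\<close>, so a maximal path means being on
  every roof.\<close>

lemma itinerary_max_iff:
  assumes "x \<in> topspace X"
  shows "itinerary x \<in> bd_max_paths B \<longleftrightarrow> x \<notin> U"
proof -
  have step: "itinerary x (Suc n) \<in> bd_max_edges B (Suc n) \<longleftrightarrow>
      J (Suc n) (tow (Suc n) x) - flr (Suc n) x = J n (tow n x) - flr n x" for n
    using max_edge_iff[OF itinerary_edge(1)[OF assms], of n] flr_mono[OF assms, of n]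
      flr_range[OF assms, of n] flr_range[OF assms, of "Suc n"] by auto
  have zero: "J 0 (tow 0 x) - flr 0 x = 0" using level_zero level_zero_coordinates[OF assms] by simp
  have "itinerary x \<in> bd_max_paths B \<longleftrightarrow> (\<forall>n. J n (tow n x) - flr n x = 0)"
  proof -
    have "(\<forall>n. f (Suc n) = f n) \<longleftrightarrow> (\<forall>n. f n = 0)" if "f 0 = 0" for f :: "nat \<Rightarrow> nat"
    proof
      assume s: "\<forall>n. f (Suc n) = f n"
      have "f n = 0" for n by (induction n) (use that s in auto)
      then show "\<forall>n. f n = 0" ..
    qed simp
    from this[of "\<lambda>n. J n (tow n x) - flr n x", OF zero] show ?thesis
      unfolding bd_max_paths_def all_pos_iff using step itinerary_path[OF assms] by simp
  qed
  also have "\<dots> \<longleftrightarrow> x \<notin> U"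
    unfolding not_U_iff[OF assms] using flr_range[OF assms] by (auto simp: le_antisym)
  finally show ?thesis .
qed

text \<open>Minimal edges have offset \<open>0\<close>, so the floor number keeps its initial value
  \<open>1\<close> at all levels.\<close>

lemma itinerary_min_iff:
  assumes "x \<in> topspace X"
  shows "itinerary x \<in> bd_min_paths B \<longleftrightarrow> x \<notin> V"
proof -
  have "itinerary x (Suc n) \<in> bd_min_edges B (Suc n) \<longleftrightarrow> flr (Suc n) x = flr n x" for n
    using min_edge_iff[OF itinerary_edge(1)[OF assms], of n] flr_mono[OF assms, of n] by auto
  then have "itinerary x \<in> bd_min_paths B \<longleftrightarrow> (\<forall>n. flr (Suc n) x = flr n x)"
    unfolding bd_min_paths_def all_pos_iff using itinerary_path[OF assms] by simp
  also have "\<dots> \<longleftrightarrow> (\<forall>n. flr n x = 1)"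
  proof
    assume s: "\<forall>n. flr (Suc n) x = flr n x"
    have "flr n x = 1" for n by (induction n) (use s level_zero_coordinates[OF assms] in auto)
    then show "\<forall>n. flr n x = 1" ..
  qed simp
  finally show ?thesis unfolding not_V_iff[OF assms] .
qed

section \<open>The itinerary map as a homeomorphism onto the path space\<close>

lemma inj_itinerary: "inj_on itinerary (topspace X)"
proof (rule inj_onI, rule ccontr)
  fix x y assume x: "x \<in> topspace X" and y: "y \<in> topspace X" and eq: "itinerary x = itinerary y" and "x \<noteq> y"
  have eqn: "tow n x = tow n y" "flr (Suc n) x - flr n x = flr (Suc n) y - flr n y" for n
    using fun_cong[OF eq, of "Suc n"] by simp_all
  \<comment> \<open>The path records only floor differences; the common start
    \<open>flr 0 = 1\<close> recovers the floors themselves.\<close>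
  have flr: "flr n x = flr n y" for n
  proof (induction n)
    case (Suc n)
    then show ?case using eqn(2)[of n] flr_mono[OF x, of n] flr_mono[OF y, of n] by simp
  qed (use level_zero_coordinates x y in simp)
  let ?\<S> = "\<Union>n. (\<lambda>(k, j). E n k j) ` kr_index (K n) (J n)"
  have basic: "x \<in> W \<longleftrightarrow> y \<in> W" if "W \<in> ?\<S>" for W
  proof -
    from that obtain n k j where W: "k \<in> {1..K n}" "j \<in> {1..J n k}" "W = E n k j"
      by (auto simp: kr_index_def)
    have "z \<in> W \<longleftrightarrow> tow n z = k \<and> flr n z = j" if "z \<in> topspace X" for z
      using coordinates_eq[OF W(1,2)] in_floor[OF that] W(3) by blast
    then show ?thesis using x y eqn(1) flr by simp
  qed
  \<comment> \<open>Failure to separate \<open>x\<close> from \<open>y\<close> passes from the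
    floors to finite intersections and unions, hence to all open sets.\<close>
  have indist: "x \<in> W \<longleftrightarrow> y \<in> W" if "generate_topology_on ?\<S> W" for W
    using that by induction (use basic in auto)
  have gen: "X = topology_generated_by ?\<S>" using adm by (simp add: admissible_def)
  obtain W where "openin X W" "x \<in> W" "y \<notin> W"
    using Hausdorff x y \<open>x \<noteq> y\<close> unfolding Hausdorff_space_def disjnt_def by blast
  moreover have "generate_topology_on ?\<S> W"
    using \<open>openin X W\<close> by (subst (asm) gen) (simp only: openin_topology_generated_by_iff)
  ultimately show False using indist by blast
qed

lemma itinerary_surj: "bd_paths B \<subseteq> itinerary ` topspace X"
proof
  fix \<xi> assume \<xi>: "\<xi> \<in> bd_paths B"
  \<comment> \<open>\<open>k n\<close> is the tower at level \<open>n\<close>, read off as the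
    source of the next edge so that level \<open>0\<close> is included. Below, \<open>j n\<close>
    adds the offsets to the starting floor \<open>1\<close>.\<close>
  define k where "k n = fst (snd (\<xi> (Suc n)))" for n
  define d where "d n = snd (snd (snd (\<xi> (Suc n))))" for n
  define j where "j n = Suc (\<Sum>i<n. d i)" for n
  have \<xi>0: "\<xi> 0 = undefined" using \<xi> by (simp add: paths_iff)
  have \<xi>S: "\<xi> (Suc n) = (Suc n, k n, k (Suc n), d n)" for n
  proof -
    have in1: "\<xi> (Suc n) \<in> kr_edges K J E (Suc n)" and in2: "\<xi> (Suc (Suc n)) \<in> kr_edges K J E (Suc (Suc n))"
      and match: "bd_rng B (\<xi> (Suc n)) = bd_src B (\<xi> (Suc (Suc n)))" using \<xi> by (auto simp: paths_iff)
    obtain a b c e a' b' c' e' where *: "\<xi> (Suc n) = (a, b, c, e)" "\<xi> (Suc (Suc n)) = (a', b', c', e')"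
      using prod_cases4 by metis
    show ?thesis using edgeD(1)[OF in1[unfolded *]] edgeD(1)[OF in2[unfolded *]] match
      by (simp add: * k_def d_def diagram_simps)
  qed
  have edge: "(Suc n, k n, k (Suc n), d n) \<in> kr_edges K J E (Suc n)" for n
    using \<xi> \<xi>S by (metis paths_iff)
  have k: "k n \<in> {1..K n}" for n using edgeD(2)[OF edge] .
  have k0: "k 0 = Suc 0" using k[of 0] level_zero by simp
  have j: "j n \<in> {1..J n (k n)}" for n
  proof (induction n)
    case (Suc n)
    then show ?case using edgeD(4)[OF edge[of n]] by (simp add: j_def)
  qed (simp add: j_def k0 level_zero)
  have sub: "E (Suc n) (k (Suc n)) (j (Suc n)) \<subseteq> E n (k n) (j n)" for n
    using edgeD(5)[OF edge j[of n]] by (simp add: j_def)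
  \<comment> \<open>The floors prescribed by the path are nonempty, closed and nested; a common
    point has the prescribed coordinates at every level.\<close>
  have "(\<Inter>n. E n (k n) (j n)) \<noteq> {}"
    by (rule compact_space_imp_nest[OF compact])
      (use floor_closed[OF k j] floor_nonempty[OF k j] sub in \<open>auto simp: decseq_Suc_iff\<close>)
  then obtain x where x: "\<And>n. x \<in> E n (k n) (j n)" by blast
  then have xS: "x \<in> topspace X" using floor_in_space[OF k j] by blast
  have c: "tow n x = k n" "flr n x = j n" for n using coordinates_eq[OF k j x] by auto
  have "itinerary x = \<xi>"
  proof
    fix n show "itinerary x n = \<xi> n"
      by (cases n) (simp_all add: \<xi>0 \<xi>S c j_def, simp add: itinerary_def)
  qed
  then show "\<xi> \<in> itinerary ` topspace X" using xS by blast
qed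

lemma itinerary_image: "itinerary ` topspace X = bd_paths B"
  using itinerary_surj itinerary_path by blast

text \<open>Each coordinate is locally constant: the open floor of \<open>x\<close> at level
  \<open>Suc n\<close> determines the addresses at both levels \<open>n\<close> and
  \<open>Suc n\<close>.\<close>

lemma continuous_coordinate: "continuous_map X (discrete_topology (bd_edges B (Suc n))) (\<lambda>x. itinerary x (Suc n))"
  unfolding continuous_map_def
proof (intro conjI allI impI)
  show "(\<lambda>x. itinerary x (Suc n)) \<in> topspace X \<rightarrow> topspace (discrete_topology (bd_edges B (Suc n)))"
    using itinerary_edge(1) by (auto simp: diagram_simps)
  fix W
  let ?P = "{x \<in> topspace X. itinerary x (Suc n) \<in> W}"
  show "openin X ?P"
  proof (subst openin_subopen, clarify)
    fix x assume x: "x \<in> topspace X" "itinerary x (Suc n) \<in> W"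
    let ?T = "E (Suc n) (tow (Suc n) x) (flr (Suc n) x)"
    have op: "openin X ?T" using floor_open[OF tow_range[OF x(1)] flr_range[OF x(1)]] .
    have "y \<in> ?P" if y: "y \<in> ?T" for y
    proof -
      have "y \<in> E n (tow n x) (flr n x)" using floor_nested[OF x(1)] y by blast
      then have "tow n y = tow n x" "flr n y = flr n x"
        using coordinates_eq[OF tow_range[OF x(1)] flr_range[OF x(1)]] by blast+
      moreover have "tow (Suc n) y = tow (Suc n) x" "flr (Suc n) y = flr (Suc n) x"
        using coordinates_eq[OF tow_range[OF x(1)] flr_range[OF x(1)] y] by auto
      ultimately show ?thesis using x openin_subset[OF op] y by auto
    qed
    then show "\<exists>T. openin X T \<and> x \<in> T \<and> T \<subseteq> ?P"
      using op in_floor[OF x(1)] by (intro exI[of _ ?T]) auto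
  qed
qed

lemma homeomorphic_itinerary: "homeomorphic_map X (bd_path_space B) itinerary"
proof (rule continuous_imp_homeomorphic_map)
  show "continuous_map X (bd_path_space B) itinerary"
    unfolding bd_path_space_def continuous_map_in_subtopology continuous_map_componentwise
  proof (intro conjI ballI)
    fix n :: nat assume "n \<in> {1..}"
    then obtain i where "n = Suc i" by (cases n) auto
    then show "continuous_map X (discrete_topology (bd_edges B n)) (\<lambda>x. itinerary x n)"
      using continuous_coordinate by simp
  qed (use itinerary_path in \<open>auto simp: itinerary_def\<close>)
  show "Hausdorff_space (bd_path_space B)"
    unfolding bd_path_space_def
    by (intro Hausdorff_space_subtopology) (simp add: Hausdorff_space_product_topology)
qed (use compact itinerary_image inj_itinerary path_space_top in auto)

section \<open>The path of a point follows the Vershik map\<close>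

text \<open>Floor numbers increase with the level, so a point on a base at level \<open>n\<close> is
  on a base at all earlier levels and its itinerary starts with minimal edges. The index
  \<open>Suc n\<close> reflects that \<open>bd_min_path_to\<close> takes the level after the target
  vertex.\<close>

lemma min_path_to_eq:
  assumes x: "x \<in> topspace X" "flr n x = 1"
  shows "bd_min_path_to B (Suc n) (n, tow n x) = restrict (itinerary x) {1..<Suc n}"
proof -
  have low: "flr i x = 1" if "i \<le> n" for i
  proof -
    have "flr i x \<le> flr n x" using that flr_mono[OF x(1)] by (rule lift_Suc_mono_le[rotated])
    then show ?thesis using x flr_range[OF x(1), of i] by simp
  qed
  have mn: "itinerary x (Suc i) \<in> bd_min_edges B (Suc i)" if "Suc i \<le> n" for i
    using min_edge_iff[OF itinerary_edge(1)[OF x(1)], of i] low that by simp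
  show ?thesis
    unfolding bd_min_path_to_def
  proof (rule the_equality, goal_cases)
    case 1
    have "itinerary x i \<in> bd_min_edges B i" if "i \<in> {1..<Suc n}" for i
      using mn[of "i - 1"] that by (cases i) auto
    moreover have "bd_rng B (itinerary x i) = bd_src B (itinerary x (i + 1))" if "1 \<le> i" for i
      using that by (cases i) (auto simp: diagram_simps)
    moreover have "bd_rng B (itinerary x n) = (n, tow n x)" if "0 < n"
      using that by (cases n) (auto simp: diagram_simps)
    ultimately show ?case by auto
  next
    case (2 p)
    then have p: "p \<in> (\<Pi>\<^sub>E j\<in>{1..<Suc n}. bd_min_edges B j)"
      and link: "\<And>i. 1 \<le> i \<Longrightarrow> i < n \<Longrightarrow> bd_rng B (p i) = bd_src B (p (i + 1))"
      and last: "0 < n \<Longrightarrow> bd_rng B (p n) = (n, tow n x)" by auto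
    have step: "p (Suc i) = itinerary x (Suc i)" if "Suc i \<le> n" "bd_rng B (p (Suc i)) = (Suc i, tow (Suc i) x)" for i
    proof -
      have pm: "p (Suc i) \<in> bd_min_edges B (Suc i)" using p that by auto
      obtain a m k d where e: "p (Suc i) = (a, m, k, d)" using prod_cases4 by blast
      then have "a = Suc i" "k = tow (Suc i) x" using that(2) by (auto simp: diagram_simps)
      then show ?thesis using min_edge_unique[of i m k d] pm mn[OF that(1)] by (auto simp: e)
    qed
    \<comment> \<open>Only the end vertex of \<open>p\<close> is prescribed, so uniqueness
      propagates downwards from level \<open>n\<close>: each minimal edge is determined by its
      range, and its source is the next range.\<close>
    have "p (n - t) = itinerary x (n - t) \<and> bd_rng B (p (n - t)) = (n - t, tow (n - t) x)" if "t < n" for t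
      using that
    proof (induction t)
      case 0
      then show ?case using step[of "n - 1"] last by simp
    next
      case (Suc t)
      then have IH: "p (n - t) = itinerary x (n - t)" by simp
      obtain i where i: "n - t = Suc (Suc i)" "n - Suc t = Suc i"
        using Suc.prems by (metis Suc_diff_Suc Suc_lessD gr0_conv_Suc zero_less_diff)
      have "bd_rng B (p (Suc i)) = bd_src B (p (Suc (Suc i)))" using link[of "Suc i"] i by simp
      then have "bd_rng B (p (Suc i)) = (Suc i, tow (Suc i) x)" using IH i by (simp add: diagram_simps)
      then show ?case using step[of i] i by simp
    qed
    then have same: "p i = itinerary x i" if "1 \<le> i" "i \<le> n" for i
      using that by (metis diff_diff_cancel diff_less less_le_trans zero_less_one)
    show ?case
    proof
      fix i show "p i = restrict (itinerary x) {1..<Suc n} i"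
        using same[of i] PiE_arb[OF p, of i] by (cases "i \<in> {1..<Suc n}") auto
    qed
  qed
qed

lemma vershik_itinerary:
  assumes "x \<in> U"
  shows "itinerary (h x) = vershik_map B (itinerary x)"
proof -
  have x: "x \<in> topspace X" using assms U_sub by blast
  note y = h_in(2)[OF assms]
  have "\<exists>n. flr n x \<noteq> J n (tow n x)" using not_U_iff[OF x] assms by blast
  then obtain N where N: "flr N x \<noteq> J N (tow N x)" "\<And>i. i < N \<Longrightarrow> flr i x = J i (tow i x)"
    using exists_least_iff[of "\<lambda>n. flr n x \<noteq> J n (tow n x)"] by blast
  \<comment> \<open>The single floor of level \<open>0\<close> is its own roof.\<close>
  have "N \<noteq> 0" using N(1) level_zero level_zero_coordinates[OF x] by (cases N) auto
  then obtain n where n: "N = Suc n" by (cases N) auto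
  have top: "flr i x = J i (tow i x)" if "i \<le> n" for i using N n that by simp
  have above: "flr i x < J i (tow i x)" if "Suc n \<le> i" for i
    using roof_distance_mono[OF x that] N(1) n flr_range[OF x, of "Suc n"] by auto
  have e: "(Suc n, tow n x, tow (Suc n) x, flr (Suc n) x - flr n x) \<in> kr_edges K J E (Suc n)"
    using itinerary_edge(1)[OF x] .
  \<comment> \<open>As \<open>x\<close> is on a roof at level \<open>n\<close>, its block ends
    exactly at its floor of level \<open>Suc n\<close>; the successor edge therefore has offset
    \<open>flr (Suc n) x\<close>.\<close>
  have sum: "flr (Suc n) x - flr n x + J n (tow n x) = flr (Suc n) x"
    using top[of n] flr_mono[OF x, of n] by simp
  have least: "(LEAST i. i \<ge> 1 \<and> itinerary x i \<notin> bd_max_edges B i) = Suc n"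
  proof (rule Least_equality)
    show "1 \<le> Suc n \<and> itinerary x (Suc n) \<notin> bd_max_edges B (Suc n)"
      using max_edge_iff[OF e] sum above[of "Suc n"] by simp
    fix i assume i: "1 \<le> i \<and> itinerary x i \<notin> bd_max_edges B i"
    then obtain l where l: "i = Suc l" by (cases i) auto
    show "Suc n \<le> i"
    proof (rule ccontr)
      assume "\<not> Suc n \<le> i"
      then show False
        using i l max_edge_iff[OF itinerary_edge(1)[OF x], of l] top[of i] top[of l] flr_mono[OF x, of l] by simp
    qed
  qed
  have low: "flr i (h x) = 1" if "i \<le> n" for i using h_wrap[OF assms] top[OF that] .
  have high: "tow i (h x) = tow i x" "flr i (h x) = Suc (flr i x)" if "Suc n \<le> i" for i
    using h_up[OF x above[OF that]] by auto
  have g: "itinerary (h x) (Suc n) = (Suc n, tow n (h x), tow (Suc n) x, flr (Suc n) x)"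
    using low[of n] high[of "Suc n"] by simp
  have "(Suc n, tow n (h x), tow (Suc n) x, flr (Suc n) x) \<in> kr_edges K J E (Suc n)"
    using itinerary_edge(1)[OF y, of n] low[of n] high[of "Suc n"] by simp
  then have succ: "bd_succ B (itinerary x (Suc n)) = itinerary (h x) (Suc n)"
    using succ_edge[OF e] g sum by simp
  have path: "bd_min_path_to B (Suc n) (bd_src B (itinerary (h x) (Suc n))) = restrict (itinerary (h x)) {1..<Suc n}"
    using min_path_to_eq[OF y low[of n]] by (simp add: diagram_simps)
  show ?thesis
  proof
    fix i
    show "itinerary (h x) i = vershik_map B (itinerary x) i"
      unfolding vershik_map_def least Let_def succ path
    proof (cases "i = 0 \<or> i \<le> Suc n", goal_cases)
      \<comment> \<open>Beyond level \<open>Suc n\<close> both floors entering an offset rise by one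
        under \<open>h\<close>, so these edges are unchanged.\<close>
      case 2
      then obtain l where l: "i = Suc l" "Suc n \<le> l" by (cases i) auto
      then show ?case using high[of l] high[of "Suc l"] by simp
    qed (auto simp: itinerary_def)
  qed
qed

lemma isomorphic_vershik: "isomorphic_actions (partial_action X U V h) (vershik_action B)"
  unfolding vershik_action_def
proof (rule isomorphic_actions_conjugate[OF homeomorphic_itinerary U_sub V_sub bij])
  show "itinerary ` U = bd_paths B - bd_max_paths B"
    unfolding itinerary_image[symmetric] using itinerary_max_iff U_sub by auto
  show "itinerary ` V = bd_paths B - bd_min_paths B"
    unfolding itinerary_image[symmetric] using itinerary_min_iff V_sub by auto
qed (rule vershik_itinerary)

end

lemma cantor_space_compact_Hausdorff:
  assumes "cantor_space X"
  shows "compact_space X" "Hausdorff_space X"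
proof -
  let ?C = "product_topology (\<lambda>_::nat. discrete_topology (UNIV :: bool set)) UNIV"
  have "compact_space ?C" "Hausdorff_space ?C"
    by (simp_all add: compact_space_product_topology compact_space_discrete_topology
        Hausdorff_space_product_topology)
  then show "compact_space X" "Hausdorff_space X"
    using assms homeomorphic_compact_space homeomorphic_Hausdorff_space unfolding cantor_space_def
    by blast+
qed

theorem theorem3p10:
  fixes X :: "'a topology" and U V :: "'a set" and h :: "'a \<Rightarrow> 'a"
    and K :: "nat \<Rightarrow> nat" and J :: "nat \<Rightarrow> nat \<Rightarrow> nat" and E :: "nat \<Rightarrow> nat \<Rightarrow> nat \<Rightarrow> 'a set"
  assumes "cantor_space X"
    and "openin X U" and "openin X V"
    and "topspace X - U \<noteq> {}" and "finite (topspace X - U)"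
    and "topspace X - V \<noteq> {}" and "finite (topspace X - V)"
    and "(topspace X - U) \<inter> (topspace X - V) = {}"
    and "homeomorphic_map (subtopology X U) (subtopology X V) h"
    and "minimal_partial_homeo X U V h"
    and "admissible X U V h K J E"
  shows "isomorphic_actions (partial_action X U V h) (vershik_action (kr_diagram K J E))"
proof -
  have sub: "U \<subseteq> topspace X" "V \<subseteq> topspace X" using assms(2,3) openin_subset by auto
  have "bij_betw h U V"
    using homeomorphic_imp_injective_map[OF assms(9)] homeomorphic_imp_surjective_map[OF assms(9)] sub
    by (simp add: bij_betw_def topspace_subtopology inf_absorb2)
  then interpret kr_sequence X U V h K J E
    using assms cantor_space_compact_Hausdorff sub by unfold_locales auto
  show ?thesis by (rule isomorphic_vershik)
qed

end
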